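(* Let $a,b\in \mathbb{Q}^\times$ with $a \ne b$, let $c \in \mathbb{Q}$, and let $$f_1(x) = a^6b^6+a^3b^3cx+(3a^2-b^6-b^3c)x^2,\qquad f_2(x) = 3a^4-a^3c+cx .$$ Let $C\subset \mathbb{P}^2_{\mathbb{Q}}$ be the plane quartic given by the affine equation $$F(x,y) = y^3 + f_{2}(x)y^{2} + f_1(x)y + x^4 = 0,$$ and suppose that $\mathrm{disc}(C)\ne 0$. Let $\infty=(0:1:0)\in C(\mathbb{Q})$ and $O=(0,0)\in C(\mathbb{Q})$. Then: (i) $P = (a^3, -a^4) \in C(\mathbb{Q})$, and the tangent line $L_P:\ x=a^3$ through $P$ has contact multiplicity $3$ with $C$ at $P$; the other point of intersection is $\infty$. (ii) $Q = (-a^2b^3, -a^2b^6) \in C(\mathbb{Q})$, and the tangent line $L_Q:\ y= b^3 x$ through $Q$ has contact multiplicity $3$ with $C$ at $Q$; the other point of intersection is $O$. (iii) The triples $(\infty,O,P)$, $(\infty,O,Q)$ and $(\infty,P,Q)$ define (in the sense explained in the context) elements $$\{\infty, O, P\},\quad \{\infty, O, Q\},\quad \{\infty, P, Q\}$$ of $K^T_2(C)/\mathrm{torsion}$.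
   Context: The discriminant $\mathrm{disc}(C)$ of a projective plane quartic is the discriminant of the ternary quartic form defining it; it vanishes if and only if the quartic is singular. The affine equation is understood to define its projective closure in $\mathbb{P}^2$, with affine coordinates $(x,y)$ corresponding to $(x:y:1)$. The contact multiplicity of a line with $C$ at a point is the intersection multiplicity there. For a smooth, projective, geometrically irreducible curve $C/\mathbb{Q}$ let $K_2(\mathbb{Q}(C)) = \mathbb{Q}(C)^\times\otimes_{\mathbb{Z}} \mathbb{Q}(C)^\times/\langle f\otimes (1-f): f \in \mathbb{Q}(C)^\times\setminus\{1\}\rangle$, and write $\{f,h\}$ for the class of $f\otimes h$. For a closed point $P$ of $C$ with residue field $\mathbb{Q}(P)$ the tame symbol is $T_P(\{f,h\}) = (-1)^{\mathrm{ord}_P(f)\mathrm{ord}_P(h)}\frac{f^{\mathrm{ord}_P(h)}}{h^{\mathrm{ord}_P(f)}}(P)\in \mathbb{Q}(P)^\times$, extended linearly to $K_2(\mathbb{Q}(C))$. The tame second $K$-group $K_2^T(C)$ is the subgroup of those $\alpha\in K_2(\mathbb{Q}(C))$ with $T_P(\alpha)=1$ for all closed points $P$. Torsion construction: let $R_1,R_2,R_3\in C(\mathbb{Q})$ be distinct points such that all differences $(R_i)-(R_j)$ have torsion class in $\mathrm{Pic}^0(C)$. With indices in $\mathbb{Z}/3\mathbb{Z}$, let $m_i\ge 1$ be the order of the class of $(R_{i+1})-(R_{i-1})$, let $h_i\in\mathbb{Q}(C)^\times$ satisfy $\mathrm{div}(h_i)=m_i(R_{i+1})-m_i(R_{i-1})$,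 and put $S_i=\left\{\frac{h_{i+1}}{h_{i+1}(R_{i+1})},\frac{h_{i-1}}{h_{i-1}(R_{i-1})}\right\}$. It is known that $S_i\in K_2^T(C)$ and that there is a unique element $\{R_1,R_2,R_3\}\in K_2^T(C)/\mathrm{torsion}$ with $S_i=\frac{\mathrm{lcm}(m_1,m_2,m_3)}{m_i}\{R_1,R_2,R_3\}$ for all $i$. Saying that a triple of points defines an element $\{R_1,R_2,R_3\}$ of $K_2^T(C)/\mathrm{torsion}$ means that the three points are distinct rational points whose pairwise differences are torsion in $\mathrm{Pic}^0(C)$, so that this construction applies. *)

theory Defs
  imports
    "HOL-Algebra.Algebraic_Closure_Type"
    "HOL-Algebra.Embedded_Algebras"
    "HOL-Library.Poly_Mapping"
    "HOL-Computational_Algebra.Fraction_Field"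
    "Jordan_Normal_Form.Determinant"
begin

section \<open>Ternary polynomials and forms over the rationals\<close>

text \<open>The ring \<open>\<rat>[X,Y,Z]\<close> is nested as \<open>\<rat>[Z][Y][X]\<close>: the outermost variable is \<open>X\<close>.\<close>

type_synonym tpoly = "rat poly poly poly"

definition tmonom :: "rat \<Rightarrow> nat \<times> nat \<times> nat \<Rightarrow> tpoly" where
  "tmonom r = (\<lambda>(i, j, k). Polynomial.monom (Polynomial.monom (Polynomial.monom r k) j) i)"

definition tcoeff :: "tpoly \<Rightarrow> nat \<times> nat \<times> nat \<Rightarrow> rat" where
  "tcoeff G = (\<lambda>(i, j, k). Polynomial.coeff (Polynomial.coeff (Polynomial.coeff G i) j) k)"

definition teval :: "tpoly \<Rightarrow> rat \<Rightarrow> rat \<Rightarrow> rat \<Rightarrow> rat" where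
  "teval G x y z = poly (poly (poly G [:[:x:]:]) [:y:]) z"

definition monomials :: "nat \<Rightarrow> (nat \<times> nat \<times> nat) list" where
  "monomials d = [(i, j, d - i - j). i \<leftarrow> [0..<d + 1], j \<leftarrow> [0..<d + 1 - i]]"

definition hom_component :: "nat \<Rightarrow> tpoly \<Rightarrow> tpoly" where
  "hom_component d G = (\<Sum>m\<leftarrow>monomials d. tmonom (tcoeff G m) m)"

definition is_form :: "nat \<Rightarrow> tpoly \<Rightarrow> bool" where
  "is_form d G \<longleftrightarrow> hom_component d G = G"

definition dX :: "tpoly \<Rightarrow> tpoly" where "dX G = pderiv G"
definition dY :: "tpoly \<Rightarrow> tpoly" where "dY G = map_poly pderiv G"
definition dZ :: "tpoly \<Rightarrow> tpoly" where "dZ G = map_poly (map_poly pderiv) G"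

text \<open>The form of degree \<open>d\<close> defining the projective closure of the affine curve \<open>f(x,y) = 0\<close>,
  where \<open>(x,y)\<close> corresponds to \<open>(x:y:1)\<close>. Here \<open>f \<in> \<rat>[x][y]\<close> (the outer variable is \<open>y\<close>), and \<open>d\<close>
  has to be the total degree of \<open>f\<close>.\<close>

definition homogenize :: "nat \<Rightarrow> rat poly poly \<Rightarrow> tpoly" where
  "homogenize d f =
     (\<Sum>(i, j, k)\<leftarrow>monomials d. tmonom (Polynomial.coeff (Polynomial.coeff f j) i) (i, j, k))"


section \<open>The discriminant of a ternary quartic form\<close>

text \<open>For \<open>a + b + c = 2\<close> every cubic form can be written as
  \<open>X^(a+1) A + Y^(b+1) B + Z^(c+1) C\<close>; the function \<open>split_cubic\<close> makes a definite choice of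
  \<open>(A, B, C)\<close>. The resultant below does not depend on this choice.\<close>

definition split_cubic :: "nat \<times> nat \<times> nat \<Rightarrow> tpoly \<Rightarrow> tpoly \<times> tpoly \<times> tpoly" where
  "split_cubic = (\<lambda>(a, b, c) G.
     (\<Sum>(i, j, k)\<leftarrow>filter (\<lambda>(i, j, k). i > a) (monomials 3).
        tmonom (tcoeff G (i, j, k)) (i - (a + 1), j, k),
      \<Sum>(i, j, k)\<leftarrow>filter (\<lambda>(i, j, k). i \<le> a \<and> j > b) (monomials 3).
        tmonom (tcoeff G (i, j, k)) (i, j - (b + 1), k),
      \<Sum>(i, j, k)\<leftarrow>filter (\<lambda>(i, j, k). i \<le> a \<and> j \<le> b) (monomials 3).
        tmonom (tcoeff G (i, j, k)) (i, j, k - (c + 1))))"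

definition det3 :: "'a::comm_ring_1 \<times> 'a \<times> 'a \<Rightarrow> 'a \<times> 'a \<times> 'a \<Rightarrow> 'a \<times> 'a \<times> 'a \<Rightarrow> 'a" where
  "det3 = (\<lambda>(a1, b1, c1) (a2, b2, c2) (a3, b3, c3).
     a1 * (b2 * c3 - b3 * c2) - b1 * (a2 * c3 - a3 * c2) + c1 * (a2 * b3 - a3 * b2))"

text \<open>Sylvester's determinantal formula for the resultant of three ternary cubic forms
  (Gelfand, Kapranov, Zelevinsky, Discriminants, Resultants and Multidimensional Determinants,
  Ch. 3, Sect. 4.D). The 15 quartic forms \<open>X G\<^sub>i\<close>, \<open>Y G\<^sub>i\<close>, \<open>Z G\<^sub>i\<close>, together with one
  3 by 3 determinant for each of the six monomials of degree 2, are expanded in the 15 monomials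
  of degree 4. The determinant has degree 9 in the coefficients of each \<open>G\<^sub>i\<close>, so there is no
  extraneous factor, and the order of the rows gives \<open>Res(X\<^sup>3,Y\<^sup>3,Z\<^sup>3) = 1\<close>.\<close>

definition sylvester_forms :: "tpoly \<Rightarrow> tpoly \<Rightarrow> tpoly \<Rightarrow> tpoly list" where
  "sylvester_forms G1 G2 G3 =
     [tmonom 1 m * G. G \<leftarrow> [G1, G2, G3], m \<leftarrow> monomials 1] @
     [det3 (split_cubic m G1) (split_cubic m G2) (split_cubic m G3). m \<leftarrow> monomials 2]"

definition resultant_cubics :: "tpoly \<Rightarrow> tpoly \<Rightarrow> tpoly \<Rightarrow> rat" where
  "resultant_cubics G1 G2 G3 =
     det (mat_of_rows_list 15 (map (\<lambda>H. map (tcoeff H) (monomials 4)) (sylvester_forms G1 G2 G3)))"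

text \<open>For a form \<open>F\<close> of degree \<open>n\<close> in three variables, \<open>Res(F\<^sub>X,F\<^sub>Y,F\<^sub>Z) = n^(n\<^sup>2-3n+3) disc(F)\<close>;
  for \<open>n = 4\<close> the factor is \<open>4^7\<close>.\<close>

definition disc_quartic :: "tpoly \<Rightarrow> rat" where
  "disc_quartic F = resultant_cubics (dX F) (dY F) (dZ F) / 4 ^ 7"


section \<open>Closed points of the plane and of plane curves\<close>

abbreviation tring :: "tpoly ring" where
  "tring \<equiv> ring_of_type_algebra"

definition homogeneous_prime :: "tpoly set \<Rightarrow> bool" where
  "homogeneous_prime p \<longleftrightarrow> primeideal p tring \<and> (\<forall>G\<in>p. \<forall>d. hom_component d G \<in> p)"

text \<open>The points of \<open>Proj \<rat>[X,Y,Z]\<close> are the homogeneous prime ideals that do not contain all of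
  \<open>X\<close>, \<open>Y\<close>, \<open>Z\<close>; the closed points are the maximal ones among them.\<close>

definition plane_points :: "tpoly set set" where
  "plane_points =
     {p. homogeneous_prime p \<and> \<not> {tmonom 1 (1, 0, 0), tmonom 1 (0, 1, 0), tmonom 1 (0, 0, 1)} \<subseteq> p}"

definition closed_points :: "tpoly \<Rightarrow> tpoly set set" where
  "closed_points F = {p \<in> plane_points. F \<in> p \<and> (\<forall>q\<in>plane_points. p \<subseteq> q \<longrightarrow> q = p)}"

text \<open>The closed point \<open>(x:y:z)\<close>, for rational \<open>x\<close>, \<open>y\<close>, \<open>z\<close> that are not all zero.\<close>

definition proj_point :: "rat \<Rightarrow> rat \<Rightarrow> rat \<Rightarrow> tpoly set" where
  "proj_point x y z = {G. \<forall>d. teval (hom_component d G) x y z = 0}"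

definition rational_points :: "tpoly \<Rightarrow> tpoly set set" where
  "rational_points F = {proj_point x y z | x y z. (x, y, z) \<noteq> (0, 0, 0) \<and> teval F x y z = 0}"

text \<open>The line with equation \<open>L = 0\<close> is the tangent line at the rational point \<open>p\<close> of \<open>F = 0\<close>,
  a smooth point since \<open>L \<noteq> 0\<close>.\<close>

definition is_tangent_line :: "tpoly \<Rightarrow> tpoly set \<Rightarrow> tpoly \<Rightarrow> bool" where
  "is_tangent_line F p L \<longleftrightarrow> L \<noteq> 0 \<and>
     (\<exists>x y z r. (x, y, z) \<noteq> (0, 0, 0) \<and> p = proj_point x y z \<and> teval F x y z = 0 \<and> r \<noteq> 0 \<and>
        L = tmonom (r * teval (dX F) x y z) (1, 0, 0)
          + tmonom (r * teval (dY F) x y z) (0, 1, 0)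
          + tmonom (r * teval (dZ F) x y z) (0, 0, 1))"


section \<open>Local rings and intersection multiplicities\<close>

text \<open>For a homogeneous prime \<open>p\<close> of \<open>S = \<rat>[X,Y,Z]\<close>, \<open>local_ring p\<close> is the homogeneous localization
  \<open>S\<^sub>(\<^sub>p\<^sub>)\<close>, i.e. the local ring of the plane at \<open>p\<close>, as a subring of the fraction field of \<open>S\<close>.
  For a homogeneous ideal \<open>I\<close>, \<open>local_ideal p I\<close> is the ideal of \<open>S\<^sub>(\<^sub>p\<^sub>)\<close> that it induces.\<close>

definition local_ideal :: "tpoly set \<Rightarrow> tpoly set \<Rightarrow> tpoly fract set" where
  "local_ideal p I =
     {to_fract A / to_fract B | A B. A \<in> I \<and> B \<notin> p \<and> (\<exists>d. is_form d A \<and> is_form d B)}"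

definition local_ring :: "tpoly set \<Rightarrow> tpoly fract ring" where
  "local_ring p = ring_of_type_algebra \<lparr>carrier := local_ideal p UNIV\<rparr>"

text \<open>The intersection multiplicity at a rational point \<open>p\<close> of the plane curves \<open>F = 0\<close> and
  \<open>G = 0\<close> is the dimension over \<open>\<rat>\<close> of the local ring at \<open>p\<close> modulo \<open>(F, G)\<close>.\<close>

definition has_intersection_multiplicity :: "tpoly \<Rightarrow> tpoly \<Rightarrow> tpoly set \<Rightarrow> nat \<Rightarrow> bool" where
  "has_intersection_multiplicity F G p n \<longleftrightarrow>
     (let I = local_ideal p (Idl\<^bsub>tring\<^esub> {F, G});
          A = local_ring p Quot I;
          K = {I +>\<^bsub>local_ring p\<^esub> to_fract (tmonom r (0, 0, 0)) | r. True}
      in ring.dimension A n K (carrier A))"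


section \<open>The function field and divisors of a plane curve\<close>

text \<open>In this section \<open>F\<close> is an irreducible form defining a smooth curve \<open>C\<close>. The function field of
  \<open>C\<close> is the residue field of the plane at the generic point \<open>(F)\<close> of \<open>C\<close>: its elements are the
  classes of \<open>A / B\<close> with \<open>A\<close>, \<open>B\<close> forms of the same degree and \<open>B\<close> not divisible by \<open>F\<close>.\<close>

definition function_field :: "tpoly \<Rightarrow> tpoly fract set ring" where
  "function_field F =
     (let \<eta> = Idl\<^bsub>tring\<^esub> {F} in local_ring \<eta> Quot local_ideal \<eta> \<eta>)"

definition restrict_fun :: "tpoly \<Rightarrow> tpoly fract \<Rightarrow> tpoly fract set" where
  "restrict_fun F g =
     (let \<eta> = Idl\<^bsub>tring\<^esub> {F} in local_ideal \<eta> \<eta> +>\<^bsub>local_ring \<eta>\<^esub> g)"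

text \<open>The local ring of \<open>C\<close> at a point \<open>p\<close> of \<open>C\<close>, and its maximal ideal, inside the function field.\<close>

definition curve_local_ring :: "tpoly \<Rightarrow> tpoly set \<Rightarrow> tpoly fract set set" where
  "curve_local_ring F p = restrict_fun F ` local_ideal p UNIV"

definition curve_max_ideal :: "tpoly \<Rightarrow> tpoly set \<Rightarrow> tpoly fract set set" where
  "curve_max_ideal F p = restrict_fun F ` local_ideal p p"

text \<open>\<open>has_ord F p h n\<close> says \<open>ord\<^sub>p(h) = n\<close> with respect to the discrete valuation ring at
  the closed point \<open>p\<close> of the smooth curve \<open>C\<close>: \<open>h\<close> is a unit of the local ring times the \<open>n\<close>-th
  power of a generator \<open>t\<close> of its maximal ideal. For \<open>n = 0\<close> there is no need to mention \<open>t\<close>, and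
  for \<open>n < 0\<close> the equation is written as \<open>h t^(-n) = u\<close>.\<close>

definition uniformizer :: "tpoly \<Rightarrow> tpoly set \<Rightarrow> tpoly fract set \<Rightarrow> bool" where
  "uniformizer F p t \<longleftrightarrow> t \<in> curve_max_ideal F p \<and>
     curve_max_ideal F p = {t \<otimes>\<^bsub>function_field F\<^esub> g | g. g \<in> curve_local_ring F p}"

definition has_ord :: "tpoly \<Rightarrow> tpoly set \<Rightarrow> tpoly fract set \<Rightarrow> int \<Rightarrow> bool" where
  "has_ord F p h n \<longleftrightarrow>
     (if n = 0 then h \<in> curve_local_ring F p - curve_max_ideal F p
      else \<exists>t. uniformizer F p t \<and>
        (\<exists>u \<in> curve_local_ring F p - curve_max_ideal F p.
           if n > 0 then h = u \<otimes>\<^bsub>function_field F\<^esub> (t [^]\<^bsub>function_field F\<^esub> nat n)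
           else h \<otimes>\<^bsub>function_field F\<^esub> (t [^]\<^bsub>function_field F\<^esub> nat (- n)) = u))"

text \<open>Divisors are finitely supported integer-valued functions on the closed points.\<close>

definition is_div_of :: "tpoly \<Rightarrow> tpoly fract set \<Rightarrow> (tpoly set \<Rightarrow>\<^sub>0 int) \<Rightarrow> bool" where
  "is_div_of F h D \<longleftrightarrow> Poly_Mapping.keys D \<subseteq> closed_points F \<and>
     (\<forall>p\<in>closed_points F. has_ord F p h (Poly_Mapping.lookup D p))"

definition principal_divisors :: "tpoly \<Rightarrow> (tpoly set \<Rightarrow>\<^sub>0 int) set" where
  "principal_divisors F =
     {D. \<exists>h \<in> carrier (function_field F) - {\<zero>\<^bsub>function_field F\<^esub>}. is_div_of F h D}"

text \<open>The class of a degree 0 divisor \<open>D\<close> in \<open>Pic\<^sup>0(C)\<close>, the group of divisors of degree 0 modulo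
  principal divisors, is torsion.\<close>

definition torsion_class :: "tpoly \<Rightarrow> (tpoly set \<Rightarrow>\<^sub>0 int) \<Rightarrow> bool" where
  "torsion_class F D \<longleftrightarrow> (\<exists>n\<ge>1. frag_cmul (int n) D \<in> principal_divisors F)"

text \<open>The triple defines an element \<open>{R\<^sub>1,R\<^sub>2,R\<^sub>3}\<close> of \<open>K\<^sub>2\<^sup>T(C)/torsion\<close>: this means that the
  torsion construction applies to it, i.e. the points are rational and distinct and their pairwise
  differences (of degree 0, since the points are rational) are torsion in \<open>Pic\<^sup>0(C)\<close>.\<close>

definition defines_K2T_element :: "tpoly \<Rightarrow> tpoly set \<Rightarrow> tpoly set \<Rightarrow> tpoly set \<Rightarrow> bool" where
  "defines_K2T_element F R1 R2 R3 \<longleftrightarrow>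
     {R1, R2, R3} \<subseteq> rational_points F \<and> distinct [R1, R2, R3] \<and>
     (\<forall>R\<in>{R1, R2, R3}. \<forall>R'\<in>{R1, R2, R3}. torsion_class F (frag_of R - frag_of R'))"

end

theory Submission
  imports Defs
begin

text \<open>The whole statement can be read off from four ways of writing the equation of \<open>C\<close>. With
\<open>N = X - a^3 Z\<close>, \<open>M = Y - b^3 X\<close>, \<open>T = Y + a^4 Z\<close> and \<open>T' = X + a^2 b^3 Z\<close> one has
\<open>C = X^4 + Z V\<^sub>Z = X^4 + Y V\<^sub>Y = N V\<^sub>P + Z T^3 = M V\<^sub>Q + X T'^3\<close>
for suitable cubic forms \<open>V\<close> (lemmas \<open>quartic_Z\<close>, \<open>quartic_Y\<close>, \<open>quartic_P\<close>, \<open>quartic_Q\<close>).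
So \<open>Z = 0\<close> and \<open>Y = 0\<close> meet the curve only at \<open>\<infinity>\<close> and only at \<open>O\<close>, each with multiplicity 4, while
\<open>N = 0\<close> meets it three times at \<open>P\<close> and once at \<open>\<infinity>\<close>, and \<open>M = 0\<close> three times at \<open>Q\<close> and
once at \<open>O\<close>. The contact statements are contained in this. For the torsion statement, the divisors of
the linear forms are \<open>4\<infinity>\<close>, \<open>4O\<close>, \<open>3P + \<infinity>\<close> and \<open>3Q + O\<close>, so that the quintic forms
\<open>Z^4 Y\<close>, \<open>Y^4 Z\<close>, \<open>N^4 Y\<close> and \<open>M^4 Z\<close> have the divisors \<open>12R + 4O + 4\<infinity>\<close> for
\<open>R = \<infinity>, O, P, Q\<close>. The quotient of any two of them is a function with divisor \<open>12(R - R')\<close>, hence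
every difference of the four points is torsion of order dividing 12.

\<^medskip>
The multiplicities require that the cofactor \<open>V\<close> does not vanish at the point in question, that is,
smoothness of \<open>C\<close> there. At \<open>\<infinity>\<close> and \<open>O\<close> this is automatic, the values being 1 and \<open>a^6 b^6\<close>.
At \<open>P\<close> and \<open>Q\<close> the gradient of \<open>C\<close> is the value of the cofactor times the coefficient vector of the
line, and a common zero of the three partial derivatives gives a kernel vector of Sylvester's
matrix, so that the discriminant would vanish (\<open>resultant_cubics_eq_0\<close>). The value at \<open>P\<close> contains the
factor \<open>a + b^3\<close>, which is why \<open>P\<close> and \<open>Q\<close> are distinct points.

\<^medskip>
The function field makes sense because \<open>C\<close> is irreducible: as a monic polynomial in \<open>X\<close> it satisfies
Eisenstein's criterion at the prime \<open>Z\<close> (\<open>prime_elem_hyperflex\<close>), an algebraic form of the total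
ramification at a hyperflex. Orders are handled by explicit congruences: a relation
\<open>V A \<equiv> U T^k\<close> modulo \<open>C\<close>, with forms \<open>U\<close> and \<open>V\<close> that do not vanish at \<open>p\<close>, witnesses that \<open>A\<close>
vanishes to order \<open>k\<close> at \<open>p\<close> (\<open>local_order\<close>, \<open>has_ord_quotient\<close>), and such relations can be multiplied.\<close>

section \<open>Monomials and forms\<close>

fun mdeg :: "nat \<times> nat \<times> nat \<Rightarrow> nat" where
  "mdeg (i, j, k) = i + j + k"

definition tX :: tpoly where "tX = tmonom 1 (1, 0, 0)"
definition tY :: tpoly where "tY = tmonom 1 (0, 1, 0)"
definition tZ :: tpoly where "tZ = tmonom 1 (0, 0, 1)"
abbreviation tconst :: "rat \<Rightarrow> tpoly" where "tconst r \<equiv> tmonom r (0, 0, 0)"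

lemma tcoeff_tmonom: "tcoeff (tmonom r m) n = (if m = n then r else 0)"
  by (cases m; cases n) (auto simp: tcoeff_def tmonom_def)

lemma tcoeff_0 [simp]: "tcoeff 0 m = 0"
  by (cases m) (simp add: tcoeff_def)

lemma tcoeff_add: "tcoeff (A + B) m = tcoeff A m + tcoeff B m"
  by (cases m) (simp add: tcoeff_def)

lemma tcoeff_sum: "tcoeff (\<Sum>x\<in>S. f x) m = (\<Sum>x\<in>S. tcoeff (f x) m)"
  by (cases m) (simp add: tcoeff_def coeff_sum)

lemma tpoly_eqI: "(\<And>m. tcoeff A m = tcoeff B m) \<Longrightarrow> A = B"
  by (auto simp: tcoeff_def poly_eq_iff)

lemma tmonom_0 [simp]: "tmonom 0 m = 0"
  by (cases m) (simp add: tmonom_def)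

lemma tmonom_add: "tmonom (r + s) m = tmonom r m + tmonom s m"
  by (cases m) (simp add: tmonom_def add_monom)

lemma tmonom_uminus: "tmonom (- r) m = - tmonom r m"
  by (cases m) (simp add: tmonom_def minus_monom)

lemma tmonom_mult: "tmonom r (i, j, k) * tmonom s (i', j', k') = tmonom (r * s) (i + i', j + j', k + k')"
  by (simp add: tmonom_def mult_monom)

lemma tconst_1 [simp]: "tconst 1 = 1"
  by (simp add: tmonom_def)

text \<open>Both sides of an identity that is additive in a polynomial need to be compared on monomials only;
this is how the multiplicative behaviour of \<open>hom_component\<close> is obtained below.\<close>
lemma tpoly_induct [case_names monom add]:
  assumes monom: "\<And>r m. P (tmonom r m)" and add: "\<And>A B. P A \<Longrightarrow> P B \<Longrightarrow> P (A + B)"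
  shows "P A"
proof -
  have sum: "P (\<Sum>x\<in>S. f x)" if "finite S" "\<And>x. P (f x)" for S :: "nat set" and f
    using that monom[of 0 undefined] by (induction S rule: finite_induct) (auto intro: add)
  have "P (Polynomial.monom (Polynomial.monom r j) i)" for r i j
  proof -
    have "Polynomial.monom (Polynomial.monom r j) i = (\<Sum>k\<le>degree r. tmonom (Polynomial.coeff r k) (i, j, k))"
      by (subst (1) poly_as_sum_of_monoms[of r, symmetric]) (simp add: monom_sum tmonom_def)
    then show ?thesis using sum monom by simp
  qed
  then have "P (Polynomial.monom q i)" for q i
    using sum[of "{..degree q}" "\<lambda>j. Polynomial.monom (Polynomial.monom (Polynomial.coeff q j) j) i"]
    by (simp add: monom_sum[symmetric] poly_as_sum_of_monoms)
  then show ?thesis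
    using sum[of "{..degree A}" "\<lambda>i. Polynomial.monom (Polynomial.coeff A i) i"]
    by (simp add: poly_as_sum_of_monoms)
qed

lemma set_monomials: "set (monomials d) = {m. mdeg m = d}"
  by (auto simp: monomials_def image_iff)

lemma distinct_monomials: "distinct (monomials d)"
  unfolding monomials_def
proof (rule distinct_concat)
  show "distinct (map (\<lambda>i. map (\<lambda>j. (i, j, d - i - j)) [0..<d + 1 - i]) [0..<d + 1])"
  proof (subst distinct_map, intro conjI inj_onI)
    fix i i' assume i: "i \<in> set [0..<d + 1]" "i' \<in> set [0..<d + 1]"
      and eq: "map (\<lambda>j. (i, j, d - i - j)) [0..<d + 1 - i] = map (\<lambda>j. (i', j, d - i' - j)) [0..<d + 1 - i']"
    have "hd (map (\<lambda>j. (i, j, d - i - j)) [0..<d + 1 - i]) = (i, 0, d - i)" if "i \<le> d" for i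
      using that by (subst hd_map) auto
    with i eq show "i = i'"
      by (metis Pair_inject Suc_eq_plus1 atLeastLessThan_iff less_Suc_eq_le set_upt)
  qed simp
qed (auto simp: distinct_map inj_on_def)

lemma finite_mdeg: "finite {m. mdeg m = d}"
  unfolding set_monomials[symmetric] by simp

lemma sum_monomials: "(\<Sum>m\<leftarrow>monomials d. f m) = (\<Sum>m | mdeg m = d. f m)"
  by (simp add: sum_list_distinct_conv_sum_set distinct_monomials set_monomials)

lemma hom_component_sum: "hom_component d A = (\<Sum>m | mdeg m = d. tmonom (tcoeff A m) m)"
  by (simp add: hom_component_def sum_monomials)

lemma tcoeff_hom_component: "tcoeff (hom_component d A) m = (if mdeg m = d then tcoeff A m else 0)"
  by (simp add: hom_component_sum tcoeff_sum tcoeff_tmonom finite_mdeg)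

lemma is_form_iff: "is_form d A \<longleftrightarrow> (\<forall>m. tcoeff A m \<noteq> 0 \<longrightarrow> mdeg m = d)"
  unfolding is_form_def by (metis tcoeff_hom_component tpoly_eqI)

lemma is_form_hom_component [simp]: "is_form d (hom_component d A)"
  by (auto simp: is_form_iff tcoeff_hom_component split: if_splits)

lemma hom_component_form: "is_form d A \<Longrightarrow> hom_component e A = (if e = d then A else 0)"
proof (rule tpoly_eqI)
  fix m assume "is_form d A"
  then have "tcoeff A m \<noteq> 0 \<Longrightarrow> mdeg m = d" unfolding is_form_iff by blast
  then show "tcoeff (hom_component e A) m = tcoeff (if e = d then A else 0) m"
    by (cases "tcoeff A m = 0") (simp_all add: tcoeff_hom_component)
qed

lemma is_form_0 [simp]: "is_form d 0"
  by (simp add: is_form_iff)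

lemma is_form_tmonom: "mdeg m = d \<Longrightarrow> is_form d (tmonom r m)"
  by (auto simp: is_form_iff tcoeff_tmonom split: if_splits)

lemma is_form_add: "is_form d A \<Longrightarrow> is_form d B \<Longrightarrow> is_form d (A + B)"
  unfolding is_form_iff
proof (intro allI impI)
  fix m assume *: "\<forall>m. tcoeff A m \<noteq> 0 \<longrightarrow> mdeg m = d" "\<forall>m. tcoeff B m \<noteq> 0 \<longrightarrow> mdeg m = d"
    and "tcoeff (A + B) m \<noteq> 0"
  then have "tcoeff A m \<noteq> 0 \<or> tcoeff B m \<noteq> 0" by (auto simp: tcoeff_add)
  with * show "mdeg m = d" by blast
qed

lemma form_induct [consumes 1, case_names zero monom add]:
  assumes "is_form d A" and "P 0" and "\<And>r m. mdeg m = d \<Longrightarrow> P (tmonom r m)"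
    and "\<And>A B. is_form d A \<Longrightarrow> is_form d B \<Longrightarrow> P A \<Longrightarrow> P B \<Longrightarrow> P (A + B)"
  shows "P A"
proof -
  have "is_form d (\<Sum>m\<in>S. tmonom (tcoeff A m) m) \<and> P (\<Sum>m\<in>S. tmonom (tcoeff A m) m)"
    if "finite S" "S \<subseteq> {m. mdeg m = d}" for S
    using that by (induction S rule: finite_induct) (auto intro: assms(2-4) is_form_add is_form_tmonom)
  from this[OF finite_mdeg order_refl] show ?thesis
    using assms(1) by (simp add: is_form_def hom_component_sum)
qed

lemma is_form_mult: "is_form d A \<Longrightarrow> is_form e B \<Longrightarrow> is_form (d + e) (A * B)"
proof (induction rule: form_induct)
  case (monom r m)
  from monom(2,1) show ?case
  proof (induction rule: form_induct)
    case (monom s n)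
    then show ?case by (cases m; cases n) (auto simp: tmonom_mult intro!: is_form_tmonom)
  qed (auto simp: distrib_left intro: is_form_add)
qed (auto simp: distrib_right intro: is_form_add)

lemma is_form_tconst [simp]: "is_form 0 (tconst r)"
  by (rule is_form_tmonom) simp

lemma is_form_1 [simp]: "is_form 0 1"
  using is_form_tconst[of 1] by simp

lemma is_form_mult': "is_form d A \<Longrightarrow> is_form e B \<Longrightarrow> f = d + e \<Longrightarrow> is_form f (A * B)"
  using is_form_mult by blast

lemma is_form_cmult: "is_form d A \<Longrightarrow> is_form d (tconst r * A)"
  by (rule is_form_mult'[OF is_form_tconst]) auto

lemma is_form_uminus: "is_form d A \<Longrightarrow> is_form d (- A)"
  using is_form_cmult[of d A "-1"] by (simp add: tmonom_uminus)

lemma is_form_diff: "is_form d A \<Longrightarrow> is_form d B \<Longrightarrow> is_form d (A - B)"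
  using is_form_add[OF _ is_form_uminus, of d A B] by simp

lemma is_form_power: "is_form d A \<Longrightarrow> is_form (n * d) (A ^ n)"
  by (induction n) (auto simp: is_form_1 is_form_mult)

lemma is_form_power': "is_form d A \<Longrightarrow> e = n * d \<Longrightarrow> is_form e (A ^ n)"
  using is_form_power by blast

lemma is_form_coordinates [simp]: "is_form (Suc 0) tX" "is_form (Suc 0) tY" "is_form (Suc 0) tZ"
  unfolding tX_def tY_def tZ_def by (rule is_form_tmonom, simp)+

lemma hom_component_add: "hom_component d (A + B) = hom_component d A + hom_component d B"
  by (intro tpoly_eqI) (simp add: tcoeff_hom_component tcoeff_add)

lemma hom_component_0 [simp]: "hom_component d 0 = 0"
  by (intro tpoly_eqI) (simp add: tcoeff_hom_component)

lemma hom_component_tmonom: "hom_component d (tmonom r m) = (if mdeg m = d then tmonom r m else 0)"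
  using hom_component_form[OF is_form_tmonom] by auto

text \<open>Multiplication of polynomials is graded, so homogeneous components convolve. This yields that the
ideal of a rational point is prime.\<close>
lemma hom_component_mult:
  "hom_component d (A * B) = (\<Sum>i\<le>d. hom_component i A * hom_component (d - i) B)"
proof (induction A rule: tpoly_induct)
  case (monom r m)
  show ?case
  proof (induction B rule: tpoly_induct)
    case (monom s n)
    have "(\<Sum>i\<le>d. hom_component i (tmonom r m) * hom_component (d - i) (tmonom s n))
        = (\<Sum>i\<le>d. if i = mdeg m then tmonom r m * hom_component (d - mdeg m) (tmonom s n) else 0)"
      by (intro sum.cong) (auto simp: hom_component_tmonom)
    also have "\<dots> = (if mdeg m + mdeg n = d then tmonom r m * tmonom s n else 0)"
      by (auto simp: hom_component_tmonom)
    also have "\<dots> = hom_component d (tmonom r m * tmonom s n)"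
      by (cases m; cases n) (auto simp: tmonom_mult hom_component_tmonom)
    finally show ?case by simp
  qed (simp add: hom_component_add distrib_left sum.distrib)
qed (simp add: hom_component_add distrib_right sum.distrib)

lemma sum_hom_components: "\<exists>N. \<forall>n\<ge>N. A = (\<Sum>d\<le>n. hom_component d A)"
proof (induction A rule: tpoly_induct)
  case (monom r m)
  then show ?case by (intro exI[of _ "mdeg m"]) (auto simp: hom_component_tmonom)
next
  case (add A B)
  then obtain N M where "\<forall>n\<ge>N. A = (\<Sum>d\<le>n. hom_component d A)" "\<forall>n\<ge>M. B = (\<Sum>d\<le>n. hom_component d B)"
    by blast
  then show ?case
    by (intro exI[of _ "max N M"]) (auto simp: hom_component_add sum.distrib)
qed

lemma teval_add [simp]: "teval (A + B) x y z = teval A x y z + teval B x y z"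
  and teval_mult [simp]: "teval (A * B) x y z = teval A x y z * teval B x y z"
  and teval_0 [simp]: "teval 0 x y z = 0"
  and teval_1 [simp]: "teval 1 x y z = 1"
  and teval_uminus [simp]: "teval (- A) x y z = - teval A x y z"
  and teval_diff [simp]: "teval (A - B) x y z = teval A x y z - teval B x y z"
  and teval_power [simp]: "teval (A ^ n) x y z = teval A x y z ^ n"
  by (simp_all add: teval_def)

lemma teval_tmonom [simp]: "teval (tmonom r (i, j, k)) x y z = r * x ^ i * y ^ j * z ^ k"
  by (simp add: teval_def tmonom_def poly_monom poly_const_pow[symmetric])

lemma teval_coordinates [simp]: "teval tX x y z = x" "teval tY x y z = y" "teval tZ x y z = z"
  by (simp_all add: tX_def tY_def tZ_def)

lemma teval_sum: "teval (\<Sum>i\<in>S. f i) x y z = (\<Sum>i\<in>S. teval (f i) x y z)"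
  by (induction S rule: infinite_finite_induct) auto

section \<open>Ideals of a ring given by a type\<close>

lemma ring_of_type_simps [simp]:
  "carrier ring_of_type_algebra = UNIV"
  "(\<otimes>\<^bsub>ring_of_type_algebra\<^esub>) = (*)"
  "\<one>\<^bsub>ring_of_type_algebra\<^esub> = 1"
  "\<zero>\<^bsub>ring_of_type_algebra\<^esub> = 0"
  "(\<oplus>\<^bsub>ring_of_type_algebra\<^esub>) = (+)"
  by (simp_all add: ring_of_type_algebra_def)

lemma a_inv_ring_of_type [simp]:
  fixes x :: "'a :: comm_ring_1"
  shows "\<ominus>\<^bsub>ring_of_type_algebra\<^esub> x = - x"
proof -
  interpret cring "ring_of_type_algebra :: 'a ring" by rule
  show ?thesis by (rule minus_equality) auto
qed

lemma ideal_of_type_iff: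
  fixes I :: "'a :: comm_ring_1 set"
  shows "ideal I ring_of_type_algebra \<longleftrightarrow>
    0 \<in> I \<and> (\<forall>x\<in>I. \<forall>y\<in>I. x + y \<in> I) \<and> (\<forall>x\<in>I. \<forall>r. r * x \<in> I)" (is "?L \<longleftrightarrow> ?R")
proof
  assume ?L
  then interpret ideal I "ring_of_type_algebra :: 'a ring" .
  show ?R
    using additive_subgroup.a_closed[OF additive_subgroup_axioms]
      additive_subgroup.zero_closed[OF additive_subgroup_axioms] I_l_closed by simp
next
  interpret cring "ring_of_type_algebra :: 'a ring" by rule
  assume R: ?R
  show ?L
  proof (rule idealI)
    show "subgroup I (add_monoid ring_of_type_algebra)"
    proof (rule add.subgroupI)
      fix x assume "x \<in> I"
      then have "(-1) * x \<in> I" using R by blast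
      then show "\<ominus>\<^bsub>ring_of_type_algebra\<^esub> x \<in> I" by simp
    qed (use R in auto)
  qed (use R ring_axioms in \<open>auto simp: mult.commute\<close>)
qed

lemma ideal_of_typeD:
  fixes I :: "'a :: comm_ring_1 set"
  assumes "ideal I ring_of_type_algebra"
  shows "0 \<in> I" "x \<in> I \<Longrightarrow> y \<in> I \<Longrightarrow> x + y \<in> I" "x \<in> I \<Longrightarrow> r * x \<in> I" "x \<in> I \<Longrightarrow> x * r \<in> I"
    "x \<in> I \<Longrightarrow> - x \<in> I" "x \<in> I \<Longrightarrow> y \<in> I \<Longrightarrow> x - y \<in> I" "x - y \<in> I \<Longrightarrow> x \<in> I \<longleftrightarrow> y \<in> I"
proof -
  note R = assms[unfolded ideal_of_type_iff]
  show add: "x + y \<in> I" if "x \<in> I" "y \<in> I" for x y using R that by blast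
  show "0 \<in> I" and "x \<in> I \<Longrightarrow> r * x \<in> I" and "x \<in> I \<Longrightarrow> x * r \<in> I"
    using R by (auto simp: mult.commute)
  show minus: "- x \<in> I" if "x \<in> I" for x
  proof -
    have "(-1) * x \<in> I" using R that by blast
    then show ?thesis by simp
  qed
  show diff: "x - y \<in> I" if "x \<in> I" "y \<in> I" for x y
    using add[OF that(1) minus[OF that(2)]] by simp
  show "x \<in> I \<longleftrightarrow> y \<in> I" if "x - y \<in> I"
    using add[OF that, of y] diff[OF _ that, of x] by auto
qed

lemma primeideal_of_type_iff:
  fixes p :: "'a :: comm_ring_1 set"
  shows "primeideal p ring_of_type_algebra \<longleftrightarrow>
    ideal p ring_of_type_algebra \<and> 1 \<notin> p \<and> (\<forall>x y. x * y \<in> p \<longrightarrow> x \<in> p \<or> y \<in> p)" (is "?L \<longleftrightarrow> ?R")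
proof
  assume ?L
  then interpret primeideal p "ring_of_type_algebra :: 'a ring" .
  show ?R using I_notcarr I_prime is_ideal one_imp_carrier by auto
next
  interpret cring "ring_of_type_algebra :: 'a ring" by rule
  assume ?R then show ?L by (intro primeidealI) (auto simp: is_cring)
qed

text \<open>The equivalences in the third and fourth item let the simplifier decide membership of products and
powers from that of the factors.\<close>
lemma primeideal_of_typeD:
  fixes p :: "'a :: comm_ring_1 set"
  assumes "primeideal p ring_of_type_algebra"
  shows "ideal p ring_of_type_algebra" "1 \<notin> p" "x * y \<in> p \<longleftrightarrow> x \<in> p \<or> y \<in> p" "x ^ n \<in> p \<longleftrightarrow> n > 0 \<and> x \<in> p"
proof -
  note R = assms[unfolded primeideal_of_type_iff]
  show "ideal p ring_of_type_algebra" "1 \<notin> p" using R by auto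
  show *: "x * y \<in> p \<longleftrightarrow> x \<in> p \<or> y \<in> p" for x y
    using R ideal_of_typeD(3)[of p y x] ideal_of_typeD(4)[of p x y] by blast
  have "1 \<notin> p" using R by simp
  then show "x ^ n \<in> p \<longleftrightarrow> n > 0 \<and> x \<in> p"
    by (induction n) (auto simp: *)
qed

lemma ideal_UNIV: "ideal UNIV (ring_of_type_algebra :: 'a :: comm_ring_1 ring)"
  by (simp add: ideal_of_type_iff)

lemma ideal_multiples: "ideal {x. F dvd x} (ring_of_type_algebra :: 'a :: comm_ring_1 ring)"
  by (simp add: ideal_of_type_iff)

lemma Idl_eqI:
  fixes I :: "'a :: comm_ring_1 set"
  assumes "ideal I ring_of_type_algebra" "S \<subseteq> I"
    and "\<And>J. ideal J ring_of_type_algebra \<Longrightarrow> S \<subseteq> J \<Longrightarrow> I \<subseteq> J"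
  shows "Idl\<^bsub>ring_of_type_algebra\<^esub> S = I"
  unfolding genideal_def using assms by auto

lemma Idl_singleton: "Idl\<^bsub>ring_of_type_algebra\<^esub> {F :: 'a :: comm_ring_1} = {x. F dvd x}"
  by (rule Idl_eqI) (auto simp: ideal_multiples intro: ideal_of_typeD(4) elim!: dvdE)

lemma Idl_pair: "Idl\<^bsub>ring_of_type_algebra\<^esub> {F, G :: 'a :: comm_ring_1} = {u * F + v * G | u v. True}"
proof (rule Idl_eqI)
  show "ideal {u * F + v * G | u v. True} ring_of_type_algebra"
    unfolding ideal_of_type_iff
  proof (intro conjI ballI allI)
    show "0 \<in> {u * F + v * G | u v. True}" by (auto intro!: exI[of _ 0])
  next
    fix x y assume "x \<in> {u * F + v * G | u v. True}" "y \<in> {u * F + v * G | u v. True}"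
    then obtain u v u' v' where "x = u * F + v * G" "y = u' * F + v' * G" by blast
    then have "x + y = (u + u') * F + (v + v') * G" by (simp add: algebra_simps)
    then show "x + y \<in> {u * F + v * G | u v. True}" by blast
  next
    fix x r assume "x \<in> {u * F + v * G | u v. True}"
    then obtain u v where "x = u * F + v * G" by blast
    then have "r * x = (r * u) * F + (r * v) * G" by (simp add: algebra_simps)
    then show "r * x \<in> {u * F + v * G | u v. True}" by blast
  qed
  have "F = 1 * F + 0 * G" "G = 0 * F + 1 * G" by auto
  then show "{F, G} \<subseteq> {u * F + v * G | u v. True}" by blast
qed (auto intro!: ideal_of_typeD(2,3))

section \<open>Homogeneous localization\<close>

lemma local_idealI:
  "A \<in> I \<Longrightarrow> B \<notin> p \<Longrightarrow> is_form d A \<Longrightarrow> is_form d B \<Longrightarrow> to_fract A / to_fract B \<in> local_ideal p I"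
  unfolding local_ideal_def by blast

lemma local_idealE:
  assumes "g \<in> local_ideal p I"
  obtains A B d where "g = to_fract A / to_fract B" "A \<in> I" "B \<notin> p" "is_form d A" "is_form d B"
  using assms unfolding local_ideal_def by blast

context
  fixes p :: "tpoly set"
  assumes p: "primeideal p tring"
begin

lemma nonzero_outside: "B \<notin> p \<Longrightarrow> B \<noteq> 0"
  using ideal_of_typeD(1)[OF primeideal_of_typeD(1)[OF p]] by blast

lemma local_ideal_add:
  assumes I: "ideal I tring" and g: "g \<in> local_ideal p I" and h: "h \<in> local_ideal p I"
  shows "g + h \<in> local_ideal p I"
proof -
  obtain A B d where g: "g = to_fract A / to_fract B" "A \<in> I" "B \<notin> p" "is_form d A" "is_form d B"
    using g by (rule local_idealE)
  obtain A' B' e where h: "h = to_fract A' / to_fract B'" "A' \<in> I" "B' \<notin> p" "is_form e A'" "is_form e B'"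
    using h by (rule local_idealE)
  have "to_fract (A * B' + A' * B) / to_fract (B * B') \<in> local_ideal p I"
  proof (rule local_idealI)
    show "A * B' + A' * B \<in> I"
      by (intro ideal_of_typeD(2)[OF I] ideal_of_typeD(4)[OF I] g h)
    show "B * B' \<notin> p" using g h primeideal_of_typeD(3)[OF p] by simp
    show "is_form (d + e) (A * B' + A' * B)"
      using is_form_mult[OF g(4) h(5)] is_form_mult[OF h(4) g(5)]
      by (simp add: is_form_add add.commute)
    show "is_form (d + e) (B * B')" by (rule is_form_mult[OF g(5) h(5)])
  qed
  also have "to_fract (A * B' + A' * B) / to_fract (B * B') = g + h"
    using g h nonzero_outside by (simp add: field_simps)
  finally show ?thesis .
qed

lemma local_ideal_mult:
  assumes I: "ideal I tring" and g: "g \<in> local_ideal p I" and h: "h \<in> local_ideal p UNIV"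
  shows "g * h \<in> local_ideal p I"
proof -
  obtain A B d where g: "g = to_fract A / to_fract B" "A \<in> I" "B \<notin> p" "is_form d A" "is_form d B"
    using g by (rule local_idealE)
  obtain A' B' e where h: "h = to_fract A' / to_fract B'" "B' \<notin> p" "is_form e A'" "is_form e B'"
    using h by (rule local_idealE)
  have "to_fract (A * A') / to_fract (B * B') \<in> local_ideal p I"
  proof (rule local_idealI)
    show "A * A' \<in> I" by (rule ideal_of_typeD(4)[OF I g(2)])
    show "B * B' \<notin> p" using g h primeideal_of_typeD(3)[OF p] by simp
  qed (rule is_form_mult[OF g(4) h(3)] is_form_mult[OF g(5) h(4)])+
  then show ?thesis using g h by simp
qed

lemma local_ideal_subset: "local_ideal p I \<subseteq> local_ideal p UNIV"
  unfolding local_ideal_def by blast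

lemma const_in_local_ring: "to_fract (tconst r) \<in> local_ideal p UNIV"
  using local_idealI[of "tconst r" UNIV 1 p 0] primeideal_of_typeD(2)[OF p] is_form_tconst is_form_1
  by simp

lemma local_ideal_uminus:
  assumes "ideal I tring" and g: "g \<in> local_ideal p I"
  shows "- g \<in> local_ideal p I"
  using local_ideal_mult[OF assms const_in_local_ring[of "-1"]] by (simp add: tmonom_uminus)

lemma local_ring_simps [simp]:
  "carrier (local_ring p) = local_ideal p UNIV"
  "(\<otimes>\<^bsub>local_ring p\<^esub>) = (*)"
  "\<one>\<^bsub>local_ring p\<^esub> = 1"
  "\<zero>\<^bsub>local_ring p\<^esub> = 0"
  "(\<oplus>\<^bsub>local_ring p\<^esub>) = (+)"
  by (simp_all add: local_ring_def)

lemma local_ring_cring: "cring (local_ring p)"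
proof -
  interpret cring "ring_of_type_algebra :: tpoly fract ring" by rule
  have "subring (local_ideal p UNIV) ring_of_type_algebra"
    using const_in_local_ring[of 1] local_ideal_uminus[OF ideal_UNIV]
      local_ideal_mult[OF ideal_UNIV] local_ideal_add[OF ideal_UNIV]
    by (intro subringI) simp_all
  then have "subcring (local_ideal p UNIV) ring_of_type_algebra"
    by (rule subcringI')
  then show ?thesis
    unfolding local_ring_def using subcring_iff by simp
qed

lemma local_ideal_ideal:
  assumes I: "ideal I tring"
  shows "ideal (local_ideal p I) (local_ring p)"
proof -
  interpret cring "local_ring p" by (rule local_ring_cring)
  have minus: "\<ominus>\<^bsub>local_ring p\<^esub> g = - g" if "g \<in> local_ideal p UNIV" for g
    using that by (intro minus_equality) (simp_all add: local_ideal_uminus[OF ideal_UNIV])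
  have "0 \<in> local_ideal p I"
    using local_idealI[of 0 I 1 p 0] ideal_of_typeD(1)[OF I] primeideal_of_typeD(2)[OF p] is_form_1 by simp
  then show ?thesis
    using local_ideal_subset[of I]
    by (intro idealI add.subgroupI ring_axioms)
       (auto simp: minus subset_iff mult.commute
          intro: local_ideal_uminus[OF I] local_ideal_mult[OF I] local_ideal_add[OF I])
qed

text \<open>Elements of a quotient of the local ring are compared through representatives: all later
computations in function fields and in rings of intersections are reduced to fractions this way.\<close>
lemma local_coset_eq_iff:
  assumes I: "ideal I tring" and g: "g \<in> local_ideal p UNIV" "h \<in> local_ideal p UNIV"
  shows "local_ideal p I +>\<^bsub>local_ring p\<^esub> g = local_ideal p I +>\<^bsub>local_ring p\<^esub> h \<longleftrightarrow> g - h \<in> local_ideal p I"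
proof -
  interpret cring "local_ring p" by (rule local_ring_cring)
  have "\<ominus>\<^bsub>local_ring p\<^esub> h = - h"
    using g by (intro minus_equality) (simp_all add: local_ideal_uminus[OF ideal_UNIV])
  then have "g \<ominus>\<^bsub>local_ring p\<^esub> h = g - h" by (simp add: a_minus_def)
  then show ?thesis
    using quotient_eq_iff_same_a_r_cos[OF local_ideal_ideal[OF I], of g h] g by simp
qed

end

lemma local_ideal_power:
  assumes p: "primeideal p tring" and g: "g \<in> local_ideal p UNIV"
  shows "g ^ n \<in> local_ideal p UNIV"
proof (induction n)
  case 0
  show ?case using const_in_local_ring[OF p, of 1] by simp
next
  case (Suc n)
  then show ?case using local_ideal_mult[OF p ideal_UNIV g] by simp
qed

lemma local_coset_mult:
  assumes p: "primeideal p tring" and I: "ideal I tring"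
    and "g \<in> local_ideal p UNIV" "h \<in> local_ideal p UNIV"
  shows "(local_ideal p I +>\<^bsub>local_ring p\<^esub> g) \<otimes>\<^bsub>local_ring p Quot local_ideal p I\<^esub>
      (local_ideal p I +>\<^bsub>local_ring p\<^esub> h) = local_ideal p I +>\<^bsub>local_ring p\<^esub> (g * h)"
  using ideal.rcoset_mult_add[OF local_ideal_ideal[OF p I], of g h] assms
  by (simp add: FactRing_def local_ring_simps[OF p])

lemma local_coset_power:
  assumes p: "primeideal p tring" and I: "ideal I tring" and g: "g \<in> local_ideal p UNIV"
  shows "(local_ideal p I +>\<^bsub>local_ring p\<^esub> g) [^]\<^bsub>local_ring p Quot local_ideal p I\<^esub> (n :: nat)
     = local_ideal p I +>\<^bsub>local_ring p\<^esub> (g ^ n)"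
proof (induction n)
  case 0
  interpret Q: ring "local_ring p Quot local_ideal p I"
    by (rule ideal.quotient_is_ring[OF local_ideal_ideal[OF p I]])
  show ?case by (simp add: FactRing_def local_ring_simps[OF p])
next
  case (Suc n)
  interpret Q: ring "local_ring p Quot local_ideal p I"
    by (rule ideal.quotient_is_ring[OF local_ideal_ideal[OF p I]])
  show ?case
    using Suc local_coset_mult[OF p I local_ideal_power[OF p g] g] by (simp add: mult.commute)
qed

section \<open>Points of the plane\<close>

lemma plane_pointsD:
  assumes "p \<in> plane_points"
  shows "primeideal p tring" and "G \<in> p \<Longrightarrow> hom_component d G \<in> p"
    and "\<not> (tX \<in> p \<and> tY \<in> p \<and> tZ \<in> p)"
  using assms unfolding plane_points_def homogeneous_prime_def tX_def tY_def tZ_def by auto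

lemma closed_pointsD:
  assumes "p \<in> closed_points F"
  shows "p \<in> plane_points" "F \<in> p" "primeideal p tring"
  using assms plane_pointsD(1) unfolding closed_points_def by auto

lemma homogeneous_mem_iff:
  assumes p: "p \<in> plane_points"
  shows "G \<in> p \<longleftrightarrow> (\<forall>d. hom_component d G \<in> p)"
proof
  assume *: "\<forall>d. hom_component d G \<in> p"
  note I = primeideal_of_typeD(1)[OF plane_pointsD(1)[OF p]]
  have "(\<Sum>d\<le>n. hom_component d G) \<in> p" for n
    by (induction n) (auto simp: * intro: ideal_of_typeD(2)[OF I])
  then show "G \<in> p" using sum_hom_components[of G] by (metis order_refl)
qed (use plane_pointsD(2)[OF p] in blast)

text \<open>A system of linear coordinates of the plane. It is used at the point \<open>T = N = 0\<close>, where \<open>W\<close> serves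
as denominator; on a curve through this point with tangent line \<open>N = 0\<close>, the form \<open>T\<close> gives a local
parameter.\<close>
definition linear_frame :: "tpoly \<Rightarrow> tpoly \<Rightarrow> tpoly \<Rightarrow> bool" where
  "linear_frame T N W \<longleftrightarrow> is_form 1 T \<and> is_form 1 N \<and> is_form 1 W \<and>
     (\<forall>L. is_form 1 L \<longrightarrow> (\<exists>\<alpha> \<beta> \<gamma>. L = tconst \<alpha> * T + tconst \<beta> * N + tconst \<gamma> * W))"

lemma tconst_mult: "tconst r * tconst s = tconst (r * s)"
  by (simp add: tmonom_mult)

lemma monomial_Suc_cases:
  assumes "mdeg m = Suc d"
  obtains L m' where "L \<in> {tX, tY, tZ}" "mdeg m' = d" "\<forall>r. tmonom r m = L * tmonom r m'"
proof -
  obtain i j k where m: "m = (i, j, k)" by (cases m)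
  consider i' where "i = Suc i'" | j' where "j = Suc j'" | k' where "k = Suc k'"
    using assms m by (cases i; cases j; cases k) auto
  then show thesis
  proof cases
    case 1 show ?thesis by (rule that[of tX "(i', j, k)"]) (use 1 assms m in \<open>auto simp: tmonom_mult tX_def tY_def tZ_def\<close>)
  next
    case 2 show ?thesis by (rule that[of tY "(i, j', k)"]) (use 2 assms m in \<open>auto simp: tmonom_mult tX_def tY_def tZ_def\<close>)
  next
    case 3 show ?thesis by (rule that[of tZ "(i, j, k')"]) (use 3 assms m in \<open>auto simp: tmonom_mult tX_def tY_def tZ_def\<close>)
  qed
qed

lemma linear_frameI:
  assumes "is_form 1 T" "is_form 1 N" "is_form 1 W"
    and "tX = tconst a1 * T + tconst b1 * N + tconst c1 * W"
    and "tY = tconst a2 * T + tconst b2 * N + tconst c2 * W"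
    and "tZ = tconst a3 * T + tconst b3 * N + tconst c3 * W"
  shows "linear_frame T N W"
proof -
  let ?S = "\<lambda>L. \<exists>\<alpha> \<beta> \<gamma>. L = tconst \<alpha> * T + tconst \<beta> * N + tconst \<gamma> * W"
  have "?S L" if "is_form 1 L" for L
    using that
  proof (induction rule: form_induct)
    case zero
    show ?case by (intro exI[of _ 0]) simp
  next
    case (monom r m)
    then have "mdeg m = Suc 0" by simp
    then obtain L m' where L: "L \<in> {tX, tY, tZ}" "mdeg m' = 0" "\<forall>r. tmonom r m = L * tmonom r m'"
      using monomial_Suc_cases by metis
    have "m' = (0, 0, 0)" using L(2) by (cases m') simp
    then have eq: "tmonom r m = tconst r * L" using L(3) by simp
    have "?S L" using L(1) assms(4-6) by blast
    then obtain x y z where "L = tconst x * T + tconst y * N + tconst z * W" by blast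
    then have "tmonom r m = tconst (r * x) * T + tconst (r * y) * N + tconst (r * z) * W"
      by (simp add: eq algebra_simps tconst_mult[symmetric])
    then show ?case by blast
  next
    case (add A B)
    obtain x y z where "A = tconst x * T + tconst y * N + tconst z * W" using add.IH(1) by blast
    moreover obtain x' y' z' where "B = tconst x' * T + tconst y' * N + tconst z' * W"
      using add.IH(2) by blast
    ultimately have "A + B = tconst (x + x') * T + tconst (y + y') * N + tconst (z + z') * W"
      by (simp add: algebra_simps tmonom_add)
    then show ?case by blast
  qed
  then show ?thesis using assms(1-3) unfolding linear_frame_def by blast
qed

lemma linear_frameD:
  assumes "linear_frame T N W"
  shows "is_form 1 T" "is_form 1 N" "is_form 1 W"
    and "is_form 1 L \<Longrightarrow> \<exists>\<alpha> \<beta> \<gamma>. L = tconst \<alpha> * T + tconst \<beta> * N + tconst \<gamma> * W"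
  using assms unfolding linear_frame_def by auto

text \<open>The Taylor expansion of a form at the point \<open>T = N = 0\<close>, up to first order. In degree 0 there are no
linear terms; requiring \<open>U = V = 0\<close> in that case keeps the truncated degree \<open>d - 1\<close> harmless.\<close>
lemma frame_decompose:
  assumes frame: "linear_frame T N W" and A: "is_form d A"
  shows "\<exists>U V c. is_form (d - 1) U \<and> is_form (d - 1) V \<and> (d = 0 \<longrightarrow> U = 0 \<and> V = 0) \<and>
           A = T * U + N * V + tconst c * W ^ d"
proof -
  let ?S = "\<lambda>d A. \<exists>U V c. is_form (d - 1) U \<and> is_form (d - 1) V \<and> (d = 0 \<longrightarrow> U = 0 \<and> V = 0) \<and>
           A = T * U + N * V + tconst c * W ^ d"
  have S_monom: "?S d (tmonom r m)" if "mdeg m = d" for r m d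
    using that
  proof (induction d arbitrary: m)
    case 0
    then have "m = (0, 0, 0)" by (cases m) simp
    then show ?case by (intro exI[of _ 0] exI[of _ r]) auto
  next
    case (Suc d)
    obtain L m' where L: "L \<in> {tX, tY, tZ}" "mdeg m' = d" "\<forall>r. tmonom r m = L * tmonom r m'"
      using monomial_Suc_cases[OF Suc.prems] by metis
    define B where "B = tmonom r m'"
    have B: "is_form d B" unfolding B_def by (rule is_form_tmonom[OF L(2)])
    obtain U V c where UV: "is_form (d - 1) U" "is_form (d - 1) V" "d = 0 \<longrightarrow> U = 0 \<and> V = 0"
      "B = T * U + N * V + tconst c * W ^ d" using Suc.IH[OF L(2)] unfolding B_def by blast
    have "is_form 1 L" using L(1) is_form_coordinates by auto
    then obtain x y z where xyz: "L = tconst x * T + tconst y * N + tconst z * W"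
      using linear_frameD(4)[OF frame] by blast
    have form: "is_form d (W * U')" if "is_form (d - 1) U'" "d = 0 \<longrightarrow> U' = 0" for U'
      using is_form_mult[OF linear_frameD(3)[OF frame] that(1)] that(2) by (cases d) auto
    have WB: "W * B = T * (W * U) + N * (W * V) + tconst c * W ^ Suc d"
      by (subst UV(4)) (simp add: algebra_simps)
    have "tmonom r m = T * (tconst x * B) + N * (tconst y * B) + tconst z * (W * B)"
      unfolding L(3)[rule_format] B_def[symmetric] xyz by (simp add: algebra_simps)
    also have "\<dots> = T * (tconst x * B + tconst z * (W * U)) + N * (tconst y * B + tconst z * (W * V))
            + tconst (z * c) * W ^ Suc d"
      unfolding WB tconst_mult[symmetric] by (simp add: algebra_simps)
    finally have eq: "tmonom r m = T * (tconst x * B + tconst z * (W * U))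
            + N * (tconst y * B + tconst z * (W * V)) + tconst (z * c) * W ^ Suc d" .
    have "is_form d (tconst x * B + tconst z * (W * U))" "is_form d (tconst y * B + tconst z * (W * V))"
      using UV(1-3) B form by (auto intro!: is_form_add is_form_cmult)
    with eq show ?case
      by (intro exI[of _ "tconst x * B + tconst z * (W * U)"]
          exI[of _ "tconst y * B + tconst z * (W * V)"] exI[of _ "z * c"]) simp
  qed
  from A show ?thesis
  proof (induction rule: form_induct)
    case zero
    show ?case by (intro exI[of _ 0]) auto
  next
    case (monom r m)
    then show ?case using S_monom by blast
  next
    case (add A B)
    obtain U V c where 1: "is_form (d - 1) U" "is_form (d - 1) V" "d = 0 \<longrightarrow> U = 0 \<and> V = 0"
      "A = T * U + N * V + tconst c * W ^ d" using add.IH(1) by blast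
    obtain U' V' c' where 2: "is_form (d - 1) U'" "is_form (d - 1) V'" "d = 0 \<longrightarrow> U' = 0 \<and> V' = 0"
      "B = T * U' + N * V' + tconst c' * W ^ d" using add.IH(2) by blast
    have "A + B = T * (U + U') + N * (V + V') + tconst (c + c') * W ^ d"
      using 1 2 by (simp add: algebra_simps tmonom_add)
    then show ?case
      using is_form_add[OF 1(1) 2(1)] is_form_add[OF 1(2) 2(2)] 1(3) 2(3)
      by (intro exI[of _ "U + U'"] exI[of _ "V + V'"] exI[of _ "c + c'"]) auto
  qed
qed

lemma tconst_notin:
  assumes p: "primeideal p tring" and "tconst c \<in> p"
  shows "c = 0"
proof (rule ccontr)
  assume "c \<noteq> 0"
  then have "tconst c * tconst (1 / c) = 1" by (simp add: tconst_mult)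
  then show False
    using ideal_of_typeD(4)[OF primeideal_of_typeD(1)[OF p] assms(2), of "tconst (1 / c)"]
      primeideal_of_typeD(2)[OF p] by simp
qed

lemma frame_notin:
  assumes "linear_frame T N W" "p \<in> plane_points" "T \<in> p" "N \<in> p"
  shows "W \<notin> p"
proof
  assume "W \<in> p"
  note I = primeideal_of_typeD(1)[OF plane_pointsD(1)[OF assms(2)]]
  have "L \<in> p" if "is_form 1 L" for L
    using linear_frameD(4)[OF assms(1) that] assms(3,4) \<open>W \<in> p\<close> by (auto intro!: ideal_of_typeD(2,3)[OF I])
  then show False using plane_pointsD(3)[OF assms(2)] by simp
qed

text \<open>The constant term of the expansion has to vanish, since \<open>p\<close> contains neither \<open>W\<close> nor a nonzero
constant.\<close>
lemma frame_form_mem: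
  assumes frame: "linear_frame T N W" and p: "primeideal p tring" "T \<in> p" "N \<in> p" "W \<notin> p"
    and A: "is_form d A" "A \<in> p"
  shows "\<exists>U V. is_form (d - 1) U \<and> is_form (d - 1) V \<and> (d = 0 \<longrightarrow> U = 0 \<and> V = 0) \<and> A = T * U + N * V"
proof -
  note I = primeideal_of_typeD(1)[OF p(1)]
  obtain U V c where UV: "is_form (d - 1) U" "is_form (d - 1) V" "d = 0 \<longrightarrow> U = 0 \<and> V = 0"
      "A = T * U + N * V + tconst c * W ^ d" using frame_decompose[OF frame A(1)] by blast
  have "T * U + N * V \<in> p" using p by (intro ideal_of_typeD(2,4)[OF I])
  then have "A - (T * U + N * V) \<in> p" by (rule ideal_of_typeD(6)[OF I A(2)])
  then have "tconst c * W ^ d \<in> p" using UV(4) by simp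
  then have "tconst c \<in> p" using p(4) primeideal_of_typeD(3,4)[OF p(1)] by blast
  then have "c = 0" by (rule tconst_notin[OF p(1)])
  then show ?thesis using UV by auto
qed

text \<open>A rational point is cut out by two linear forms: by the expansion, the forms in a homogeneous prime
that contains them are exactly those with constant term 0, and a homogeneous ideal is determined by
its forms. The lemma identifies points on a curve without any computation of residue fields, and it
shows that rational points are closed.\<close>
lemma plane_point_unique:
  assumes frame: "linear_frame T N W" and p: "p \<in> plane_points" "T \<in> p" "N \<in> p"
    and q: "q \<in> plane_points" "T \<in> q" "N \<in> q"
  shows "p = q"
proof -
  have *: "A \<in> q" if p: "p \<in> plane_points" "T \<in> p" "N \<in> p" and q: "q \<in> plane_points" "T \<in> q" "N \<in> q"
    and A: "is_form d A" "A \<in> p" for A d p q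
  proof -
    note I = primeideal_of_typeD(1)[OF plane_pointsD(1)[OF q(1)]]
    obtain U V where "A = T * U + N * V"
      using frame_form_mem[OF frame plane_pointsD(1)[OF p(1)] p(2,3) frame_notin[OF frame p] A] by blast
    then show ?thesis using q(2,3) by (auto intro!: ideal_of_typeD(2,4)[OF I])
  qed
  have "G \<in> p \<longleftrightarrow> G \<in> q" for G
    unfolding homogeneous_mem_iff[OF p(1), of G] homogeneous_mem_iff[OF q(1), of G]
    using *[OF p q is_form_hom_component] *[OF q p is_form_hom_component] by blast
  then show ?thesis by blast
qed

lemma mem_proj_point_iff: "is_form d A \<Longrightarrow> A \<in> proj_point x y z \<longleftrightarrow> teval A x y z = 0"
  by (auto simp: proj_point_def hom_component_form)

text \<open>Primality is proved as for the kernel of \<open>G \<mapsto> G(xt, yt, zt) \<in> \<rat>[t]\<close>: the lowest components of two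
polynomials that do not vanish at the point give a component of the product that does not vanish.\<close>
lemma proj_point_plane_point:
  assumes "(x, y, z) \<noteq> (0, 0, 0)"
  shows "proj_point x y z \<in> plane_points"
proof -
  let ?p = "proj_point x y z"
  let ?e = "\<lambda>d A. teval (hom_component d A) x y z"
  have mult: "?e d (A * B) = (\<Sum>i\<le>d. ?e i A * ?e (d - i) B)" for d A B
    by (simp add: hom_component_mult teval_sum)
  have ideal: "ideal ?p tring"
    unfolding ideal_of_type_iff by (auto simp: proj_point_def hom_component_add mult)
  have "A \<in> ?p \<or> B \<in> ?p" if AB: "A * B \<in> ?p" for A B
  proof (rule ccontr)
    assume neg: "\<not> (A \<in> ?p \<or> B \<in> ?p)"
    define i where "i = (LEAST i. ?e i A \<noteq> 0)"
    define j where "j = (LEAST j. ?e j B \<noteq> 0)"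
    have ex: "\<exists>i. ?e i A \<noteq> 0" "\<exists>j. ?e j B \<noteq> 0" using neg by (auto simp: proj_point_def)
    have i: "?e i A \<noteq> 0" "\<And>i'. i' < i \<Longrightarrow> ?e i' A = 0"
      using LeastI_ex[OF ex(1)] not_less_Least[of _ "\<lambda>i. ?e i A \<noteq> 0"] unfolding i_def by blast+
    have j: "?e j B \<noteq> 0" "\<And>j'. j' < j \<Longrightarrow> ?e j' B = 0"
      using LeastI_ex[OF ex(2)] not_less_Least[of _ "\<lambda>j. ?e j B \<noteq> 0"] unfolding j_def by blast+
    have "?e (i + j) (A * B) = (\<Sum>k\<le>i + j. if k = i then ?e i A * ?e j B else 0)"
      unfolding mult
    proof (rule sum.cong)
      fix k assume "k \<in> {..i + j}"
      then have "k < i \<or> k = i \<or> k > i \<and> i + j - k < j" by auto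
      then show "?e k A * ?e (i + j - k) B = (if k = i then ?e i A * ?e j B else 0)"
        using i(2)[of k] j(2)[of "i + j - k"] by (elim disjE) simp_all
    qed simp
    then show False using AB i(1) j(1) by (simp add: proj_point_def)
  qed
  moreover have "1 \<notin> ?p" using mem_proj_point_iff[OF is_form_1] by simp
  ultimately have "primeideal ?p tring" using ideal unfolding primeideal_of_type_iff by blast
  moreover have "hom_component d A \<in> ?p" if "A \<in> ?p" for d A
    using that by (simp add: mem_proj_point_iff[OF is_form_hom_component]) (simp add: proj_point_def)
  moreover have "\<not> {tX, tY, tZ} \<subseteq> ?p"
    using assms mem_proj_point_iff[OF is_form_coordinates(1)] mem_proj_point_iff[OF is_form_coordinates(2)]
      mem_proj_point_iff[OF is_form_coordinates(3)] by auto
  ultimately show ?thesis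
    unfolding plane_points_def homogeneous_prime_def tX_def tY_def tZ_def by blast
qed

lemma closed_pointI:
  assumes "linear_frame T N W" "p \<in> plane_points" "T \<in> p" "N \<in> p" "F \<in> p"
  shows "p \<in> closed_points F"
  unfolding closed_points_def
proof (intro CollectI conjI ballI impI)
  fix q assume "q \<in> plane_points" "p \<subseteq> q"
  then show "q = p" using plane_point_unique[OF assms(1) _ _ _ assms(2-4)] assms(3,4) by blast
qed (use assms in auto)

section \<open>The function field and orders of vanishing\<close>

lemma to_fract_power: "to_fract (A ^ n) = to_fract A ^ n"
  by (induction n) simp_all

text \<open>The form \<open>A\<close> of degree \<open>d\<close> equals a unit times \<open>T^k\<close> in the local ring of \<open>F = 0\<close> at \<open>p\<close>, expressed
with numerators and denominators cleared. The balance of degrees makes the quotient \<open>U / V\<close> usable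
after division by powers of a linear form.\<close>
definition local_order :: "tpoly \<Rightarrow> tpoly set \<Rightarrow> tpoly \<Rightarrow> nat \<Rightarrow> tpoly \<Rightarrow> nat \<Rightarrow> bool" where
  "local_order F p T d A k \<longleftrightarrow> is_form d A \<and>
     (\<exists>eu ev U V. is_form eu U \<and> is_form ev V \<and> U \<notin> p \<and> V \<notin> p \<and> eu + k = ev + d \<and>
        F dvd V * A - U * T ^ k)"

lemma local_orderI:
  "is_form d A \<Longrightarrow> is_form eu U \<Longrightarrow> is_form ev V \<Longrightarrow> U \<notin> p \<Longrightarrow> V \<notin> p \<Longrightarrow> eu + k = ev + d \<Longrightarrow>
     F dvd V * A - U * T ^ k \<Longrightarrow> local_order F p T d A k"
  unfolding local_order_def by blast

lemma local_orderE:
  assumes "local_order F p T d A k"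
  obtains eu ev U V where "is_form d A" "is_form eu U" "is_form ev V" "U \<notin> p" "V \<notin> p"
    "eu + k = ev + d" "F dvd V * A - U * T ^ k"
  using assms unfolding local_order_def by blast

lemma local_order_unit:
  assumes "primeideal p tring" "is_form d A" "A \<notin> p"
  shows "local_order F p T d A 0"
  by (rule local_orderI[where U = A and V = 1 and ev = 0 and eu = d])
     (use assms primeideal_of_typeD(2) in auto)

lemma local_order_mult:
  assumes p: "primeideal p tring" and A: "local_order F p T d A k" and B: "local_order F p T e B l"
  shows "local_order F p T (d + e) (A * B) (k + l)"
proof -
  obtain eu ev U V where 1: "is_form d A" "is_form eu U" "is_form ev V" "U \<notin> p" "V \<notin> p"
    "eu + k = ev + d" "F dvd V * A - U * T ^ k" using A by (rule local_orderE)
  obtain eu' ev' U' V' where 2: "is_form e B" "is_form eu' U'" "is_form ev' V'" "U' \<notin> p" "V' \<notin> p"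
    "eu' + l = ev' + e" "F dvd V' * B - U' * T ^ l" using B by (rule local_orderE)
  show ?thesis
  proof (rule local_orderI)
    have "F dvd V' * B * (V * A - U * T ^ k) + U * T ^ k * (V' * B - U' * T ^ l)"
      using 1(7) 2(7) by (intro dvd_add dvd_mult)
    also have "\<dots> = (V * V') * (A * B) - (U * U') * T ^ (k + l)"
      by (simp add: algebra_simps power_add)
    finally show "F dvd (V * V') * (A * B) - (U * U') * T ^ (k + l)" .
  qed (use 1 2 primeideal_of_typeD(3)[OF p] in \<open>auto intro: is_form_mult\<close>)
qed

context
  fixes F :: tpoly
  assumes F: "prime_elem F"
begin

abbreviation "\<eta> \<equiv> {A. F dvd A}"

lemma eta_prime: "primeideal \<eta> tring"
  unfolding primeideal_of_type_iff
  using F by (auto simp: ideal_multiples prime_elem_dvd_mult_iff)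

lemmas eta_ideal = primeideal_of_typeD(1)[OF eta_prime]

lemma restrict_fun_coset: "restrict_fun F g = local_ideal \<eta> \<eta> +>\<^bsub>local_ring \<eta>\<^esub> g"
  unfolding restrict_fun_def Idl_singleton Let_def ..

lemma function_field_Quot: "function_field F = local_ring \<eta> Quot local_ideal \<eta> \<eta>"
  unfolding function_field_def Idl_singleton Let_def ..

lemma fraction_mem: "is_form d A \<Longrightarrow> is_form d B \<Longrightarrow> \<not> F dvd B \<Longrightarrow> to_fract A / to_fract B \<in> local_ideal \<eta> UNIV"
  by (rule local_idealI) auto

text \<open>Equality of functions on the curve is divisibility by its equation after cross multiplication.\<close>
lemma restrict_fun_eq_iff:
  assumes "is_form d A" "is_form d B" "\<not> F dvd B" "is_form e A'" "is_form e B'" "\<not> F dvd B'"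
  shows "restrict_fun F (to_fract A / to_fract B) = restrict_fun F (to_fract A' / to_fract B')
     \<longleftrightarrow> F dvd A * B' - A' * B"
proof -
  let ?g = "to_fract A / to_fract B" and ?h = "to_fract A' / to_fract B'"
  have nz: "B \<noteq> 0" "B' \<noteq> 0" using assms by auto
  have eq: "?g - ?h = to_fract (A * B' - A' * B) / to_fract (B * B')"
    using nz by (simp add: field_simps)
  have "?g - ?h \<in> local_ideal \<eta> \<eta> \<longleftrightarrow> F dvd A * B' - A' * B"
  proof
    assume "?g - ?h \<in> local_ideal \<eta> \<eta>"
    then obtain C D n where CD: "?g - ?h = to_fract C / to_fract D" "C \<in> \<eta>" "D \<notin> \<eta>"
      by (rule local_idealE)
    then have "D \<noteq> 0" by auto
    have "to_fract (A * B' - A' * B) / to_fract (B * B') = to_fract C / to_fract D"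
      using CD(1) unfolding eq .
    then have "to_fract ((A * B' - A' * B) * D) = to_fract (C * (B * B'))"
      using nz \<open>D \<noteq> 0\<close> by (simp add: frac_eq_eq)
    then have "(A * B' - A' * B) * D = C * (B * B')" unfolding to_fract_eq_iff .
    then have "F dvd (A * B' - A' * B) * D" using CD(2) by simp
    then show "F dvd A * B' - A' * B" using CD(3) prime_elem_dvd_mult_iff[OF F, of "A * B' - A' * B" D] by blast
  next
    assume "F dvd A * B' - A' * B"
    then show "?g - ?h \<in> local_ideal \<eta> \<eta>"
      unfolding eq
      using assms is_form_mult[OF assms(1,5)] is_form_mult[OF assms(4,2)] is_form_mult[OF assms(2,5)] F
      by (intro local_idealI[where d = "d + e"]) (auto simp: prime_elem_dvd_mult_iff add.commute intro: is_form_diff)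
  qed
  then show ?thesis
    unfolding restrict_fun_coset
    using local_coset_eq_iff[OF eta_prime eta_ideal] fraction_mem assms by blast
qed

lemma restrict_fun_mult:
  assumes "g \<in> local_ideal \<eta> UNIV" "h \<in> local_ideal \<eta> UNIV"
  shows "restrict_fun F g \<otimes>\<^bsub>function_field F\<^esub> restrict_fun F h = restrict_fun F (g * h)"
  unfolding restrict_fun_coset function_field_Quot
  by (rule local_coset_mult[OF eta_prime eta_ideal assms])

lemma restrict_fun_power:
  assumes "g \<in> local_ideal \<eta> UNIV"
  shows "restrict_fun F g [^]\<^bsub>function_field F\<^esub> (n :: nat) = restrict_fun F (g ^ n)"
  unfolding restrict_fun_coset function_field_Quot
  by (rule local_coset_power[OF eta_prime eta_ideal assms])

lemma restrict_fun_nonzero: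
  assumes "is_form d A" "is_form d B" "\<not> F dvd A" "\<not> F dvd B"
  shows "restrict_fun F (to_fract A / to_fract B) \<in> carrier (function_field F) - {\<zero>\<^bsub>function_field F\<^esub>}"
proof -
  have mem: "to_fract A / to_fract B \<in> local_ideal \<eta> UNIV" by (rule fraction_mem) fact+
  interpret R: cring "local_ring \<eta>" by (rule local_ring_cring[OF eta_prime])
  have I: "ideal (local_ideal \<eta> \<eta>) (local_ring \<eta>)" by (rule local_ideal_ideal[OF eta_prime eta_ideal])
  have "restrict_fun F (to_fract 0 / to_fract 1) = \<zero>\<^bsub>function_field F\<^esub>"
    using I by (simp add: restrict_fun_coset function_field_Quot FactRing_def
        local_ring_simps(4)[OF eta_prime, symmetric] R.a_coset_add_zero additive_subgroup.a_subset
        ideal.axioms(1) del: local_ring_simps)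
  moreover have "\<not> is_unit F" using F by (auto simp: prime_elem_def)
  then have "restrict_fun F (to_fract A / to_fract B) \<noteq> restrict_fun F (to_fract 0 / to_fract 1)"
    using restrict_fun_eq_iff[of d A B 0 0 1] assms by simp
  moreover have "restrict_fun F (to_fract A / to_fract B) \<in> carrier (function_field F)"
    using mem by (auto simp: restrict_fun_coset function_field_Quot FactRing_def A_RCOSETS_def'
        local_ring_simps[OF eta_prime])
  ultimately show ?thesis by simp
qed

context
  fixes p :: "tpoly set"
  assumes p: "primeideal p tring" and Fp: "F \<in> p"
begin

lemma notin_not_dvd: "B \<notin> p \<Longrightarrow> \<not> F dvd B"
  using Fp ideal_of_typeD(4)[OF primeideal_of_typeD(1)[OF p]] by (auto elim!: dvdE)

lemma local_ideal_p_subset: "local_ideal p I \<subseteq> local_ideal \<eta> UNIV"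
  unfolding local_ideal_def using notin_not_dvd by auto

text \<open>If the unit were represented by a fraction \<open>C / D\<close> with \<open>C\<close> in \<open>p\<close>, cross multiplication modulo \<open>F\<close>
would put \<open>A D\<close> into \<open>p\<close>.\<close>
lemma restrict_unit:
  assumes "is_form d A" "is_form d B" "A \<notin> p" "B \<notin> p"
  shows "restrict_fun F (to_fract A / to_fract B) \<in> curve_local_ring F p - curve_max_ideal F p"
proof
  show "restrict_fun F (to_fract A / to_fract B) \<in> curve_local_ring F p"
    unfolding curve_local_ring_def using assms by (intro imageI local_idealI) auto
  show "restrict_fun F (to_fract A / to_fract B) \<notin> curve_max_ideal F p"
  proof
    assume "restrict_fun F (to_fract A / to_fract B) \<in> curve_max_ideal F p"
    then obtain C D e where CD: "restrict_fun F (to_fract A / to_fract B) = restrict_fun F (to_fract C / to_fract D)"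
      "C \<in> p" "D \<notin> p" "is_form e C" "is_form e D"
      unfolding curve_max_ideal_def by (auto elim!: local_idealE)
    then have "F dvd A * D - C * B"
      using restrict_fun_eq_iff[of d A B e C D] assms notin_not_dvd by simp
    then have "A * D - C * B \<in> p"
      using Fp ideal_of_typeD(4)[OF primeideal_of_typeD(1)[OF p]] by (auto elim!: dvdE)
    then have "A * D \<in> p"
      using ideal_of_typeD(7)[OF primeideal_of_typeD(1)[OF p]] primeideal_of_typeD(3)[OF p] CD(2) by blast
    then show False using assms CD(3) primeideal_of_typeD(3)[OF p] by blast
  qed
qed

lemma has_ord_0:
  assumes "is_form d A" "is_form d B" "A \<notin> p" "B \<notin> p"
  shows "has_ord F p (restrict_fun F (to_fract A / to_fract B)) 0"
  using restrict_unit[OF assms] by (simp add: has_ord_def)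

context
  fixes T N W V0 U0 :: tpoly and e :: nat
  assumes frame: "linear_frame T N W" and TN: "T \<in> p" "N \<in> p" "W \<notin> p"
    and smooth: "is_form e V0" "is_form e U0" "V0 \<notin> p" "F dvd V0 * N - U0 * T"
begin

text \<open>Smoothness enters here: a numerator in \<open>p\<close> is \<open>T U + N V\<close>, and modulo \<open>F\<close> the relation
\<open>V0 N \<equiv> U0 T\<close> turns it, up to the unit \<open>V0\<close>, into the multiple \<open>T (U V0 + V U0)\<close> of \<open>T\<close>.\<close>
lemma uniformizer_linear: "uniformizer F p (restrict_fun F (to_fract T / to_fract W))"
  unfolding uniformizer_def
proof (intro conjI equalityI subsetI)
  have T: "is_form 1 T" and N: "is_form 1 N" and W: "is_form 1 W" using linear_frameD[OF frame] by auto
  have TW: "to_fract T / to_fract W \<in> local_ideal p p" by (rule local_idealI[OF TN(1,3) T W])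
  then show "restrict_fun F (to_fract T / to_fract W) \<in> curve_max_ideal F p"
    unfolding curve_max_ideal_def by blast
  have mult: "restrict_fun F (to_fract T / to_fract W) \<otimes>\<^bsub>function_field F\<^esub> restrict_fun F g
     = restrict_fun F (to_fract T / to_fract W * g)" if "g \<in> local_ideal p UNIV" for g
    using restrict_fun_mult local_ideal_p_subset TW that by blast
  fix x
  {
    assume "x \<in> {restrict_fun F (to_fract T / to_fract W) \<otimes>\<^bsub>function_field F\<^esub> g | g. g \<in> curve_local_ring F p}"
    then obtain g where "g \<in> local_ideal p UNIV" "x = restrict_fun F (to_fract T / to_fract W * g)"
      using mult unfolding curve_local_ring_def by auto
    then show "x \<in> curve_max_ideal F p"
      using local_ideal_mult[OF p primeideal_of_typeD(1)[OF p] TW] unfolding curve_max_ideal_def by blast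
  next
    assume "x \<in> curve_max_ideal F p"
    then obtain A B d where x: "x = restrict_fun F (to_fract A / to_fract B)" "A \<in> p" "B \<notin> p"
      "is_form d A" "is_form d B"
      unfolding curve_max_ideal_def by (auto elim!: local_idealE)
    obtain U V where UV: "is_form (d - 1) U" "is_form (d - 1) V" "d = 0 \<longrightarrow> U = 0 \<and> V = 0" "A = T * U + N * V"
      using frame_form_mem[OF frame p TN x(4,2)] by blast
    let ?G = "W * (U * V0 + V * U0)"
    have G: "is_form (d + e) ?G"
    proof (cases "d = 0")
      case False
      have "is_form (1 + ((d - 1) + e)) ?G"
        using UV smooth by (intro is_form_mult W is_form_add) auto
      then show ?thesis using False by simp
    qed (use UV in simp)
    have BV: "is_form (d + e) (B * V0)" using x smooth by (intro is_form_mult)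
    have BVp: "B * V0 \<notin> p" using x smooth primeideal_of_typeD(3)[OF p] by simp
    (* the difference of the two representatives, cross multiplied *)
    have "F dvd (V * W * B) * (V0 * N - U0 * T)" using smooth by simp
    also have "\<dots> = A * (W * (B * V0)) - (T * ?G) * B"
      unfolding UV(4) by (simp add: algebra_simps)
    finally have "restrict_fun F (to_fract A / to_fract B) = restrict_fun F (to_fract (T * ?G) / to_fract (W * (B * V0)))"
      using x(3-5) is_form_mult[OF T G] is_form_mult[OF W BV] BVp TN(3) notin_not_dvd primeideal_of_typeD(3)[OF p]
      by (subst restrict_fun_eq_iff[of d A B "1 + (d + e)"]) auto
    also have "to_fract (T * ?G) / to_fract (W * (B * V0)) = to_fract T / to_fract W * (to_fract ?G / to_fract (B * V0))"
      by simp
    finally have "x = restrict_fun F (to_fract T / to_fract W) \<otimes>\<^bsub>function_field F\<^esub> restrict_fun F (to_fract ?G / to_fract (B * V0))"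
      using mult[OF local_idealI[OF UNIV_I BVp G BV]] x(1) by simp
    moreover have "restrict_fun F (to_fract ?G / to_fract (B * V0)) \<in> curve_local_ring F p"
      unfolding curve_local_ring_def by (rule imageI[OF local_idealI[OF UNIV_I BVp G BV]])
    ultimately show "x \<in> {restrict_fun F (to_fract T / to_fract W) \<otimes>\<^bsub>function_field F\<^esub> g | g. g \<in> curve_local_ring F p}"
      by blast
  }
qed

text \<open>With \<open>V A \<equiv> U T^k\<close> and \<open>V' B \<equiv> U' T^l\<close>, the quotient \<open>A / B\<close> is the unit \<open>U V' / (V U')\<close> times
\<open>T^(k - l)\<close>. The three cases correspond to those in the definition of \<open>has_ord\<close>; powers of \<open>W\<close> make
the fractions homogeneous of degree 0.\<close>
lemma has_ord_quotient:
  assumes A: "local_order F p T d A k" and B: "local_order F p T d B l" "\<not> F dvd B"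
  shows "has_ord F p (restrict_fun F (to_fract A / to_fract B)) (int k - int l)"
proof -
  obtain eu ev U V where 1: "is_form d A" "is_form eu U" "is_form ev V" "U \<notin> p" "V \<notin> p"
    "eu + k = ev + d" "F dvd V * A - U * T ^ k" using A by (rule local_orderE)
  obtain eu' ev' U' V' where 2: "is_form d B" "is_form eu' U'" "is_form ev' V'" "U' \<notin> p" "V' \<notin> p"
    "eu' + l = ev' + d" "F dvd V' * B - U' * T ^ l" using B(1) by (rule local_orderE)
  have T: "is_form 1 T" and W: "is_form 1 W" using linear_frameD[OF frame] by auto
  note notin = primeideal_of_typeD(3,4)[OF p]
  note dvd = prime_elem_dvd_mult_iff[OF F] prime_elem_dvd_power_iff[OF F]
  have nd: "\<not> F dvd V" "\<not> F dvd U'" "\<not> F dvd W" using 1 2 TN notin_not_dvd by auto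
  have Tn: "is_form n (T ^ n)" "is_form n (W ^ n)" for n
    using is_form_power'[OF T, of n n] is_form_power'[OF W, of n n] by auto
  define t where "t = restrict_fun F (to_fract T / to_fract W)"
  have TW: "to_fract T / to_fract W \<in> local_ideal \<eta> UNIV" by (rule fraction_mem[OF T W nd(3)])
  have tpow: "t [^]\<^bsub>function_field F\<^esub> n = restrict_fun F (to_fract (T ^ n) / to_fract (W ^ n))"
    and tpow_mem: "to_fract (T ^ n) / to_fract (W ^ n) \<in> local_ideal \<eta> UNIV" for n :: nat
    using restrict_fun_power[OF TW, of n] local_ideal_power[OF eta_prime TW, of n] unfolding t_def
    by (simp_all add: power_divide to_fract_power)
  have t: "uniformizer F p t" unfolding t_def by (rule uniformizer_linear)
  have key: "F dvd U' * S * (V * A - U * T ^ k) - U * R * (V' * B - U' * T ^ l)" for S R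
    by (rule dvd_diff[OF dvd_mult[OF 1(7)] dvd_mult[OF 2(7)]])
  have hAB: "to_fract A / to_fract B \<in> local_ideal \<eta> UNIV" by (rule fraction_mem[OF 1(1) 2(1) B(2)])
  consider "k = l" | n where "k = l + n" "n > 0" | n where "l = k + n" "n > 0"
    by (metis less_imp_add_positive linorder_cases)
  then show ?thesis
  proof cases
    case 1
    have u: "is_form (eu + ev') (U * V')" "is_form (eu + ev') (V * U')" "U * V' \<notin> p" "V * U' \<notin> p"
    proof -
      have "ev + eu' = eu + ev'" using \<open>eu + k = ev + d\<close> \<open>eu' + l = ev' + d\<close> 1 by simp
      then show "is_form (eu + ev') (V * U')"
        using is_form_mult[OF \<open>is_form ev V\<close> \<open>is_form eu' U'\<close>] by simp
      show "is_form (eu + ev') (U * V')" by (rule is_form_mult) fact+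
    qed (use notin \<open>U \<notin> p\<close> \<open>V' \<notin> p\<close> \<open>V \<notin> p\<close> \<open>U' \<notin> p\<close> in auto)
    have "A * (V * U') - U * V' * B = U' * 1 * (V * A - U * T ^ k) - U * 1 * (V' * B - U' * T ^ l)"
      using 1 by (simp add: algebra_simps)
    then have "restrict_fun F (to_fract A / to_fract B) = restrict_fun F (to_fract (U * V') / to_fract (V * U'))"
      using key[of 1 1] u nd
      by (subst restrict_fun_eq_iff[OF \<open>is_form d A\<close> 2(1) B(2) u(1,2)]) (auto simp: dvd)
    then show ?thesis using restrict_unit[OF u] 1 by (simp add: has_ord_def)
  next
    case (2 n)
    have u: "is_form (ev + eu') (U * V' * W ^ n)" "is_form (ev + eu') (V * U')"
      "U * V' * W ^ n \<notin> p" "V * U' \<notin> p"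
    proof -
      have "ev + eu' = (eu + ev') + n" using \<open>eu + k = ev + d\<close> \<open>eu' + l = ev' + d\<close> 2 by simp
      then show "is_form (ev + eu') (U * V' * W ^ n)"
        using is_form_mult[OF is_form_mult[OF \<open>is_form eu U\<close> \<open>is_form ev' V'\<close>] Tn(2)[of n]] by simp
      show "is_form (ev + eu') (V * U')"
        by (rule is_form_mult) fact+
    qed (use notin \<open>U \<notin> p\<close> \<open>V' \<notin> p\<close> \<open>V \<notin> p\<close> \<open>U' \<notin> p\<close> TN in auto)
    let ?u = "to_fract (U * V' * W ^ n) / to_fract (V * U')"
    have um: "?u \<in> local_ideal \<eta> UNIV" using u nd by (intro fraction_mem) (auto simp: dvd)
    have "A * (V * U' * W ^ n) - (U * V' * W ^ n * T ^ n) * B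
        = U' * W ^ n * (V * A - U * T ^ k) - U * (W ^ n * T ^ n) * (V' * B - U' * T ^ l)"
      using 2 by (simp add: algebra_simps power_add)
    then have "restrict_fun F (to_fract A / to_fract B)
       = restrict_fun F (to_fract (U * V' * W ^ n * T ^ n) / to_fract (V * U' * W ^ n))"
      using key[of "W ^ n" "W ^ n * T ^ n"] u nd
      by (subst restrict_fun_eq_iff[OF \<open>is_form d A\<close> \<open>is_form d B\<close> B(2) is_form_mult[OF u(1) Tn(1)] is_form_mult[OF u(2) Tn(2)]])
         (auto simp: dvd)
    also have "\<dots> = restrict_fun F (?u * (to_fract (T ^ n) / to_fract (W ^ n)))"
      by simp
    also have "\<dots> = restrict_fun F ?u \<otimes>\<^bsub>function_field F\<^esub> (t [^]\<^bsub>function_field F\<^esub> n)"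
      unfolding tpow by (rule restrict_fun_mult[OF um tpow_mem, symmetric])
    finally show ?thesis
      using restrict_unit[OF u] t 2 by (auto simp: has_ord_def)
  next
    case (3 n)
    have u: "is_form (ev + eu' + n) (U * V')" "is_form (ev + eu' + n) (V * U' * W ^ n)"
      "U * V' \<notin> p" "V * U' * W ^ n \<notin> p"
    proof -
      have "eu + ev' = ev + eu' + n" using \<open>eu + k = ev + d\<close> \<open>eu' + l = ev' + d\<close> 3 by simp
      then show "is_form (ev + eu' + n) (U * V')"
        using is_form_mult[OF \<open>is_form eu U\<close> \<open>is_form ev' V'\<close>] by simp
      show "is_form (ev + eu' + n) (V * U' * W ^ n)"
        using \<open>is_form ev V\<close> \<open>is_form eu' U'\<close> Tn by (intro is_form_mult)
    qed (use notin \<open>U \<notin> p\<close> \<open>V' \<notin> p\<close> \<open>V \<notin> p\<close> \<open>U' \<notin> p\<close> TN in auto)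
    have "(A * T ^ n) * (V * U' * W ^ n) - (U * V') * (B * W ^ n)
        = U' * (W ^ n * T ^ n) * (V * A - U * T ^ k) - U * W ^ n * (V' * B - U' * T ^ l)"
      using 3 by (simp add: algebra_simps power_add)
    then have "restrict_fun F (to_fract (U * V') / to_fract (V * U' * W ^ n))
       = restrict_fun F (to_fract (A * T ^ n) / to_fract (B * W ^ n))"
      using key[of "W ^ n * T ^ n" "W ^ n"] u nd B(2)
      by (subst eq_commute, subst restrict_fun_eq_iff[OF is_form_mult[OF \<open>is_form d A\<close> Tn(1)] is_form_mult[OF \<open>is_form d B\<close> Tn(2)] _ u(1,2)])
         (auto simp: dvd)
    also have "\<dots> = restrict_fun F ((to_fract A / to_fract B) * (to_fract (T ^ n) / to_fract (W ^ n)))"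
      by simp
    also have "\<dots> = restrict_fun F (to_fract A / to_fract B) \<otimes>\<^bsub>function_field F\<^esub> (t [^]\<^bsub>function_field F\<^esub> n)"
      unfolding tpow by (rule restrict_fun_mult[OF hAB tpow_mem, symmetric])
    finally show ?thesis
      using restrict_unit[OF u] t 3 by (auto simp: has_ord_def)
  qed
qed

end

end

end

section \<open>Intersection multiplicity with a line\<close>

text \<open>In a ring where every element is a scalar plus a multiple of \<open>t\<close>, each step of the chain of ideals
\<open>(1) \<supseteq> (t) \<supseteq> (t^2) \<supseteq> \<dots>\<close> adds one dimension, spanned by \<open>t^j\<close>, until the chain reaches 0.\<close>
lemma (in cring) dimension_uniserial:
  assumes K: "K \<subseteq> carrier R" and t: "t \<in> carrier R"
    and decomp: "\<And>g. g \<in> carrier R \<Longrightarrow> \<exists>k\<in>K. \<exists>g'\<in>carrier R. g = k \<oplus> t \<otimes> g'"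
    and nilpotent: "t [^] (Suc n) = \<zero>" "t [^] n \<noteq> \<zero>"
  shows "dimension (Suc n) K (carrier R)"
proof -
  define E where "E m = {t [^] m \<otimes> g | g. g \<in> carrier R}" for m :: nat
  have "dimension m K (E (Suc n - m))" if "m \<le> Suc n" for m
    using that
  proof (induction m)
    case 0
    have "E (Suc n) = {\<zero>}"
      unfolding E_def using nilpotent(1) by (auto simp del: nat_pow_Suc intro: exI[of _ \<zero>])
    then show ?case using zero_dim by simp
  next
    case (Suc m)
    define j where "j = n - m"
    have j: "Suc n - m = Suc j" "Suc n - Suc m = j" "n = j + m" using Suc.prems by (auto simp: j_def)
    have notin: "t [^] j \<notin> E (Suc j)"
    proof
      assume "t [^] j \<in> E (Suc j)"
      then obtain g where g: "g \<in> carrier R" "t [^] j = t [^] (Suc j) \<otimes> g" unfolding E_def by blast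
      have "t [^] n = t [^] m \<otimes> t [^] j"
        unfolding j(3) using t by (simp add: nat_pow_mult add.commute)
      also have "\<dots> = t [^] m \<otimes> t [^] (Suc j) \<otimes> g"
        using t g by (simp add: m_assoc del: nat_pow_Suc)
      also have "t [^] m \<otimes> t [^] (Suc j) = t [^] (Suc n)"
        unfolding j(3) using nat_pow_mult[OF t, of m "Suc j"] by (simp add: add.commute del: nat_pow_Suc)
      finally show False using nilpotent g by simp
    qed
    have "E j = line_extension K (t [^] j) (E (Suc j))"
    proof (intro equalityI subsetI)
      fix u assume "u \<in> E j"
      then obtain g where g: "g \<in> carrier R" "u = t [^] j \<otimes> g" unfolding E_def by blast
      obtain k g' where kg: "k \<in> K" "g' \<in> carrier R" "g = k \<oplus> t \<otimes> g'" using decomp[OF g(1)] by blast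
      have "u = k \<otimes> t [^] j \<oplus> t [^] (Suc j) \<otimes> g'"
        unfolding g(2) kg(3) using kg(1,2) K t by (simp add: subset_iff r_distr m_assoc m_comm)
      then show "u \<in> line_extension K (t [^] j) (E (Suc j))"
        unfolding line_extension_mem_iff E_def using kg by blast
    next
      fix u assume "u \<in> line_extension K (t [^] j) (E (Suc j))"
      then obtain k g where kg: "k \<in> K" "g \<in> carrier R" "u = k \<otimes> t [^] j \<oplus> t [^] (Suc j) \<otimes> g"
        unfolding line_extension_mem_iff E_def by blast
      then have "u = t [^] j \<otimes> (k \<oplus> t \<otimes> g)"
        using K t by (simp add: subset_iff r_distr m_assoc m_comm)
      then show "u \<in> E j" unfolding E_def using kg K t by blast
    qed
    then show ?case
      using Suc_dim[OF _ notin] Suc t unfolding j by simp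
  qed
  from this[of "Suc n"] have "dimension (Suc n) K (E 0)" by simp
  moreover have "E 0 = carrier R" unfolding E_def by (auto, metis l_one)
  ultimately show ?thesis by simp
qed

text \<open>The local ring of the intersection of \<open>F = 0\<close> with the line \<open>N = 0\<close> is \<open>\<rat>[t]/(t^(n+1))\<close> with
\<open>t = T / W\<close>: it is spanned by powers of \<open>t\<close> by the Taylor expansion, \<open>t^(n+1)\<close> vanishes because \<open>S\<close> is
a unit, and \<open>t^n\<close> does not vanish because \<open>T\<close> can be cancelled modulo \<open>N\<close>.\<close>
lemma has_intersection_multiplicity_line:
  assumes frame: "linear_frame T N W" and p: "primeideal p tring" "T \<in> p" "N \<in> p" "W \<notin> p"
    and F: "F = N * V + S * T ^ Suc n" "is_form s S" "S \<notin> p"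
    and N: "\<And>A. N dvd T * A \<Longrightarrow> N dvd A"
  shows "has_intersection_multiplicity F N p (Suc n)"
proof -
  note notin = primeideal_of_typeD(3,4)[OF p(1)]
  note pI = primeideal_of_typeD(1)[OF p(1)]
  have T: "is_form 1 T" and W: "is_form 1 W" and N1: "is_form 1 N" using linear_frameD[OF frame] by auto
  define J where "J = Idl\<^bsub>tring\<^esub> {F, N}"
  have J: "J = {u * F + v * N | u v. True}" unfolding J_def by (rule Idl_pair)
  interpret R: cring "ring_of_type_algebra :: tpoly ring" by rule
  have JI: "ideal J tring" unfolding J_def by (rule R.genideal_ideal) simp
  define I where "I = local_ideal p J"
  have II: "ideal I (local_ring p)" unfolding I_def by (rule local_ideal_ideal[OF p(1) JI])
  let ?A = "local_ring p Quot I"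
  let ?c = "\<lambda>g. I +>\<^bsub>local_ring p\<^esub> g"
  interpret A: cring ?A
    by (rule ideal.quotient_is_cring[OF II local_ring_cring[OF p(1)]])
  have carr: "carrier ?A = ?c ` local_ideal p UNIV"
    by (auto simp: FactRing_def A_RCOSETS_def' local_ring_simps[OF p(1)])
  have add: "?c g \<oplus>\<^bsub>?A\<^esub> ?c h = ?c (g + h)" if "g \<in> local_ideal p UNIV" "h \<in> local_ideal p UNIV" for g h
    using ring_hom_add[OF ideal.rcos_ring_hom[OF II], of g h] that
    by (simp add: local_ring_simps[OF p(1)])
  have mult: "?c g \<otimes>\<^bsub>?A\<^esub> ?c h = ?c (g * h)" if "g \<in> local_ideal p UNIV" "h \<in> local_ideal p UNIV" for g h
    using local_coset_mult[OF p(1) JI that] unfolding I_def .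
  have eq_iff: "?c g = ?c h \<longleftrightarrow> g - h \<in> I" if "g \<in> local_ideal p UNIV" "h \<in> local_ideal p UNIV" for g h
    using local_coset_eq_iff[OF p(1) JI that] unfolding I_def .
  have zero: "\<zero>\<^bsub>?A\<^esub> = ?c 0"
  proof -
    interpret L: cring "local_ring p" by (rule local_ring_cring[OF p(1)])
    have "?c \<zero>\<^bsub>local_ring p\<^esub> = I"
      by (rule L.a_coset_add_zero) (use ideal.axioms(1)[OF II] additive_subgroup.a_subset in blast)
    then show ?thesis by (simp add: FactRing_def local_ring_simps[OF p(1)])
  qed
  let ?K = "{?c (to_fract (tconst r)) | r. True}"
  let ?g = "to_fract T / to_fract W"
  have Tn: "is_form n (T ^ n)" "is_form n (W ^ n)" for n
    using is_form_power'[OF T, of n n] is_form_power'[OF W, of n n] by auto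
  have g: "?g \<in> local_ideal p UNIV" by (rule local_idealI[OF UNIV_I p(4) T W])
  have gpow: "?g ^ k = to_fract (T ^ k) / to_fract (W ^ k)" for k
    by (simp add: power_divide to_fract_power)
  have pow: "?c ?g [^]\<^bsub>?A\<^esub> k = ?c (?g ^ k)" for k :: nat
    using local_coset_power[OF p(1) JI g] unfolding I_def .
  have pow_0_iff: "?c ?g [^]\<^bsub>?A\<^esub> k = \<zero>\<^bsub>?A\<^esub> \<longleftrightarrow> ?g ^ k \<in> I" for k :: nat
    unfolding pow zero
    using eq_iff[OF local_ideal_power[OF p(1) g], of 0] const_in_local_ring[OF p(1), of 0] by simp
  have "A.dimension (Suc n) ?K (carrier ?A)"
  proof (rule A.dimension_uniserial)
    show "?K \<subseteq> carrier ?A" unfolding carr using const_in_local_ring[OF p(1)] by blast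
    show "?c ?g \<in> carrier ?A" unfolding carr using g by blast
    show "?c ?g [^]\<^bsub>?A\<^esub> Suc n = \<zero>\<^bsub>?A\<^esub>"
    proof -
      have "S * T ^ Suc n = 1 * F + (- V) * N" unfolding F(1) by (simp add: algebra_simps)
      then have "S * T ^ Suc n \<in> J" unfolding J by blast
      moreover have "S * W ^ Suc n \<notin> p" using F(3) p(4) notin by simp
      ultimately have "to_fract (S * T ^ Suc n) / to_fract (S * W ^ Suc n) \<in> I"
        unfolding I_def by (rule local_idealI) (rule is_form_mult[OF F(2) Tn(1)] is_form_mult[OF F(2) Tn(2)])+
      moreover have "S \<noteq> 0" using nonzero_outside[OF p(1) F(3)] .
      ultimately show ?thesis unfolding pow_0_iff gpow by simp
    qed
    show "?c ?g [^]\<^bsub>?A\<^esub> n \<noteq> \<zero>\<^bsub>?A\<^esub>"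
    proof
      assume "?c ?g [^]\<^bsub>?A\<^esub> n = \<zero>\<^bsub>?A\<^esub>"
      then have "to_fract (T ^ n) / to_fract (W ^ n) \<in> I" unfolding pow_0_iff gpow .
      then obtain A B d where AB: "to_fract (T ^ n) / to_fract (W ^ n) = to_fract A / to_fract B"
        "A \<in> J" "B \<notin> p" unfolding I_def by (rule local_idealE)
      obtain u v where A: "A = u * F + v * N" using AB(2) unfolding J by blast
      have nz: "B \<noteq> 0" "W ^ n \<noteq> 0" using nonzero_outside[OF p(1)] AB(3) p(4) by auto
      have "to_fract (T ^ n * B) = to_fract (A * W ^ n)"
        using AB(1) nz by (simp add: frac_eq_eq)
      then have "T ^ n * B = A * W ^ n" unfolding to_fract_eq_iff .
      (* modulo N the equation F is S T^(n+1), so a factor T^n can be split off *)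
      then have "T ^ n * (B - W ^ n * u * S * T) = N * (W ^ n * (u * V + v))"
        unfolding A F(1) by (simp add: algebra_simps)
      then have "N dvd T ^ n * (B - W ^ n * u * S * T)" by simp
      moreover have "N dvd T ^ m * D \<Longrightarrow> N dvd D" for m D
        by (induction m) (auto simp: mult.assoc dest: N)
      ultimately have "N dvd B - W ^ n * u * S * T" by blast
      then have "B - W ^ n * u * S * T \<in> p" using p(3) ideal_of_typeD(4)[OF pI] by (auto elim!: dvdE)
      moreover have "W ^ n * u * S * T \<in> p" using p(2) notin by simp
      ultimately show False using AB(3) ideal_of_typeD(7)[OF pI] by blast
    qed
  next
    fix x assume "x \<in> carrier ?A"
    then obtain A B d where x: "x = ?c (to_fract A / to_fract B)" "B \<notin> p" "is_form d A" "is_form d B"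
      unfolding carr by (auto elim!: local_idealE)
    obtain U1 V1 c1 where 1: "A = T * U1 + N * V1 + tconst c1 * W ^ d"
      using frame_decompose[OF frame x(3)] by blast
    obtain U2 V2 c2 where 2: "B = T * U2 + N * V2 + tconst c2 * W ^ d"
      using frame_decompose[OF frame x(4)] by blast
    have "c2 \<noteq> 0"
    proof
      assume "c2 = 0"
      then have "B \<in> p" unfolding 2 using p(2,3) by (auto intro!: ideal_of_typeD(2,4)[OF pI])
      then show False using x(2) by simp
    qed
    (* the value of the fraction A / B at the point *)
    define c where "c = c1 / c2"
    have "A - tconst c * B = T * (U1 - tconst c * U2) + N * (V1 - tconst c * V2)
        + (tconst c1 - tconst c * tconst c2) * W ^ d"
      unfolding 1 2 by (simp add: algebra_simps)
    also have "tconst c1 - tconst c * tconst c2 = 0"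
      using \<open>c2 \<noteq> 0\<close> by (simp add: tconst_mult c_def)
    finally have "A - tconst c * B \<in> p" using p(2,3) by (auto intro!: ideal_of_typeD(2,4)[OF pI])
    moreover have "is_form d (A - tconst c * B)" using x by (intro is_form_diff is_form_cmult)
    ultimately obtain U V' where UV: "is_form (d - 1) U" "is_form (d - 1) V'" "d = 0 \<longrightarrow> U = 0 \<and> V' = 0"
      "A - tconst c * B = T * U + N * V'"
      using frame_form_mem[OF frame p] by blast
    have WU: "is_form d (W * U)" and NV: "is_form d (N * V')"
      using UV(1-3) is_form_mult[OF W UV(1)] is_form_mult[OF N1 UV(2)] by (cases d; simp)+
    let ?h = "to_fract (W * U) / to_fract B"
    have h: "?h \<in> local_ideal p UNIV" by (rule local_idealI[OF UNIV_I x(2) WU x(4)])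
    have gh: "?g * ?h \<in> local_ideal p UNIV" by (rule local_ideal_mult[OF p(1) ideal_UNIV g h])
    have k: "to_fract (tconst c) \<in> local_ideal p UNIV" by (rule const_in_local_ring[OF p(1)])
    have AB: "to_fract A / to_fract B \<in> local_ideal p UNIV" by (rule local_idealI[OF UNIV_I x(2-4)])
    have "N * V' = 0 * F + V' * N" by simp
    then have "N * V' \<in> J" unfolding J by blast
    then have "to_fract (N * V') / to_fract B \<in> I" unfolding I_def by (rule local_idealI[OF _ x(2) NV x(4)])
    also have "N * V' = A - tconst c * B - T * U" using UV(4) by (simp add: algebra_simps)
    also have "to_fract (A - tconst c * B - T * U) / to_fract B = to_fract A / to_fract B - (to_fract (tconst c) + ?g * ?h)"
      using nonzero_outside[OF p(1)] x(2) p(4) by (simp add: field_simps)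
    finally have "x = ?c (to_fract (tconst c) + ?g * ?h)"
      unfolding x(1) using eq_iff[OF AB local_ideal_add[OF p(1) ideal_UNIV k gh]] by simp
    also have "\<dots> = ?c (to_fract (tconst c)) \<oplus>\<^bsub>?A\<^esub> ?c ?g \<otimes>\<^bsub>?A\<^esub> ?c ?h"
      by (simp only: mult[OF g h] add[OF k gh])
    finally show "\<exists>k\<in>?K. \<exists>g'\<in>carrier ?A. x = k \<oplus>\<^bsub>?A\<^esub> ?c ?g \<otimes>\<^bsub>?A\<^esub> g'"
      unfolding carr using h by blast
  qed
  then show ?thesis
    unfolding has_intersection_multiplicity_def Let_def I_def J_def by simp
qed

section \<open>The discriminant of a singular quartic\<close>

lemma monomials_1: "monomials 1 = [(0, 0, 1), (0, 1, 0), (1, 0, 0)]"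
  and monomials_2: "monomials 2 = [(0, 0, 2), (0, 1, 1), (0, 2, 0), (1, 0, 1), (1, 1, 0), (2, 0, 0)]"
  and monomials_4: "monomials 4 = [(0, 0, 4), (0, 1, 3), (0, 2, 2), (0, 3, 1), (0, 4, 0), (1, 0, 3),
      (1, 1, 2), (1, 2, 1), (1, 3, 0), (2, 0, 2), (2, 1, 1), (2, 2, 0), (3, 0, 1), (3, 1, 0), (4, 0, 0)]"
  by code_simp+

lemma teval_form:
  assumes "is_form d H"
  shows "teval H x y z = (\<Sum>m\<leftarrow>monomials d. tcoeff H m * teval (tmonom 1 m) x y z)"
proof -
  have "H = (\<Sum>m | mdeg m = d. tmonom (tcoeff H m) m)"
    using assms by (simp add: is_form_def hom_component_sum)
  then have "teval H x y z = (\<Sum>m | mdeg m = d. teval (tmonom (tcoeff H m) m) x y z)"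
    by (metis teval_sum)
  also have "\<dots> = (\<Sum>m | mdeg m = d. tcoeff H m * teval (tmonom 1 m) x y z)"
    by (intro sum.cong) (auto simp: mult.assoc)
  finally show ?thesis by (simp add: sum_monomials)
qed

lemma is_form_sum_list: "(\<And>x. x \<in> set xs \<Longrightarrow> is_form d (f x)) \<Longrightarrow> is_form d (\<Sum>x\<leftarrow>xs. f x)"
  by (induction xs) (auto intro: is_form_add)

lemma sum_list_split_cubic:
  fixes f :: "nat \<times> nat \<times> nat \<Rightarrow> 'a :: comm_monoid_add"
  shows "sum_list (map f (filter (\<lambda>(i, j, k). i > a) xs))
    + sum_list (map f (filter (\<lambda>(i, j, k). i \<le> a \<and> j > b) xs))
    + sum_list (map f (filter (\<lambda>(i, j, k). i \<le> a \<and> j \<le> b) xs)) = sum_list (map f xs)"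
  by (induction xs) (auto simp: add_ac)

text \<open>In the last of the three parts the exponent of \<open>Z\<close> is at least \<open>c + 1\<close>, since \<open>i \<le> a\<close>, \<open>j \<le> b\<close> and
\<open>i + j + k = 3 = a + b + c + 1\<close>.\<close>
lemma split_cubic_spec:
  assumes deg: "a + b + c = 2" and G: "is_form 3 G"
  obtains A B C where "split_cubic (a, b, c) G = (A, B, C)"
    "is_form (2 - a) A" "is_form (2 - b) B" "is_form (2 - c) C"
    "G = tmonom 1 (a + 1, 0, 0) * A + tmonom 1 (0, b + 1, 0) * B + tmonom 1 (0, 0, c + 1) * C"
proof -
  obtain A B C where ABC: "split_cubic (a, b, c) G = (A, B, C)" by (metis prod_cases3)
  let ?f = "\<lambda>m. tmonom (tcoeff G m) m"
  have sum: "M * (\<Sum>x\<leftarrow>filter P (monomials 3). g x) = sum_list (map ?f (filter P (monomials 3)))"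
    if "\<And>m. mdeg m = 3 \<Longrightarrow> P m \<Longrightarrow> M * g m = ?f m" for M P g
    unfolding sum_list_const_mult[symmetric]
    by (intro arg_cong[of _ _ sum_list] map_cong) (auto simp: set_monomials that)
  have A: "tmonom 1 (a + 1, 0, 0) * A = sum_list (map ?f (filter (\<lambda>(i, j, k). i > a) (monomials 3)))"
    and B: "tmonom 1 (0, b + 1, 0) * B = sum_list (map ?f (filter (\<lambda>(i, j, k). i \<le> a \<and> j > b) (monomials 3)))"
    and C: "tmonom 1 (0, 0, c + 1) * C = sum_list (map ?f (filter (\<lambda>(i, j, k). i \<le> a \<and> j \<le> b) (monomials 3)))"
    using ABC deg unfolding split_cubic_def by (auto intro!: sum simp: tmonom_mult)
  have "is_form (2 - a) A" "is_form (2 - b) B" "is_form (2 - c) C"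
    using ABC deg unfolding split_cubic_def
    by (auto intro!: is_form_sum_list is_form_tmonom simp: set_monomials)
  moreover have "G = sum_list (map ?f (monomials 3))"
    using G by (simp add: is_form_def hom_component_def)
  then have "G = tmonom 1 (a + 1, 0, 0) * A + tmonom 1 (0, b + 1, 0) * B + tmonom 1 (0, 0, c + 1) * C"
    unfolding A B C sum_list_split_cubic .
  ultimately show thesis using that ABC by blast
qed

lemma det3_eq_0:
  fixes x y z :: "'a :: field"
  assumes "(x, y, z) \<noteq> (0, 0, 0)"
    and "x * a1 + y * b1 + z * c1 = 0" "x * a2 + y * b2 + z * c2 = 0" "x * a3 + y * b3 + z * c3 = 0"
  shows "det3 (a1, b1, c1) (a2, b2, c2) (a3, b3, c3) = 0"
proof -
  let ?D = "a1 * (b2 * c3 - b3 * c2) - b1 * (a2 * c3 - a3 * c2) + c1 * (a2 * b3 - a3 * b2)"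
  have "x * ?D = (x * a1 + y * b1 + z * c1) * (b2 * c3 - b3 * c2)
      - (x * a2 + y * b2 + z * c2) * (b1 * c3 - b3 * c1) + (x * a3 + y * b3 + z * c3) * (b1 * c2 - b2 * c1)"
    by (simp add: algebra_simps)
  moreover have "y * ?D = - (x * a1 + y * b1 + z * c1) * (a2 * c3 - a3 * c2)
      + (x * a2 + y * b2 + z * c2) * (a1 * c3 - a3 * c1) - (x * a3 + y * b3 + z * c3) * (a1 * c2 - a2 * c1)"
    by (simp add: algebra_simps)
  moreover have "z * ?D = (x * a1 + y * b1 + z * c1) * (a2 * b3 - a3 * b2)
      - (x * a2 + y * b2 + z * c2) * (a1 * b3 - a3 * b1) + (x * a3 + y * b3 + z * c3) * (a1 * b2 - a2 * b1)"
    by (simp add: algebra_simps)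
  ultimately have "x * ?D = 0" "y * ?D = 0" "z * ?D = 0" unfolding assms(2-4) by simp_all
  then show ?thesis using assms(1) by (auto simp: det3_def)
qed

text \<open>The determinants among Sylvester's forms vanish at a common zero of the cubics by Cramer's rule:
the vector \<open>(x^(a+1), y^(b+1), z^(c+1))\<close> is a nonzero solution of the linear system.\<close>
lemma sylvester_forms_at_zero:
  assumes forms: "is_form 3 G1" "is_form 3 G2" "is_form 3 G3"
    and zeros: "teval G1 x y z = 0" "teval G2 x y z = 0" "teval G3 x y z = 0"
    and nz: "(x, y, z) \<noteq> (0, 0, 0)"
    and H: "H \<in> set (sylvester_forms G1 G2 G3)"
  shows "is_form 4 H \<and> teval H x y z = 0"
proof -
  consider m G where "m \<in> set (monomials 1)" "G \<in> {G1, G2, G3}" "H = tmonom 1 m * G"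
    | m where "m \<in> set (monomials 2)" "H = det3 (split_cubic m G1) (split_cubic m G2) (split_cubic m G3)"
    using H unfolding sylvester_forms_def by auto
  then show ?thesis
  proof cases
    case 1
    then show ?thesis
      using is_form_mult[OF is_form_tmonom[of m 1], of 3 G] forms zeros by (auto simp: set_monomials)
  next
    case 2
    obtain a b c where m: "m = (a, b, c)" by (cases m)
    have deg: "a + b + c = 2" using 2(1) by (simp add: m set_monomials)
    obtain A1 B1 C1 where 1: "split_cubic (a, b, c) G1 = (A1, B1, C1)"
      "is_form (2 - a) A1" "is_form (2 - b) B1" "is_form (2 - c) C1"
      "G1 = tmonom 1 (a + 1, 0, 0) * A1 + tmonom 1 (0, b + 1, 0) * B1 + tmonom 1 (0, 0, c + 1) * C1"
      by (rule split_cubic_spec[OF deg forms(1)])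
    obtain A2 B2 C2 where 2: "split_cubic (a, b, c) G2 = (A2, B2, C2)"
      "is_form (2 - a) A2" "is_form (2 - b) B2" "is_form (2 - c) C2"
      "G2 = tmonom 1 (a + 1, 0, 0) * A2 + tmonom 1 (0, b + 1, 0) * B2 + tmonom 1 (0, 0, c + 1) * C2"
      by (rule split_cubic_spec[OF deg forms(2)])
    obtain A3 B3 C3 where 3: "split_cubic (a, b, c) G3 = (A3, B3, C3)"
      "is_form (2 - a) A3" "is_form (2 - b) B3" "is_form (2 - c) C3"
      "G3 = tmonom 1 (a + 1, 0, 0) * A3 + tmonom 1 (0, b + 1, 0) * B3 + tmonom 1 (0, 0, c + 1) * C3"
      by (rule split_cubic_spec[OF deg forms(3)])
    have H: "H = A1 * (B2 * C3 - B3 * C2) - B1 * (A2 * C3 - A3 * C2) + C1 * (A2 * B3 - A3 * B2)"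
      using \<open>H = _\<close> unfolding m 1(1) 2(1) 3(1) det3_def by simp
    have "is_form ((2 - a) + ((2 - b) + (2 - c))) (A1 * (B2 * C3 - B3 * C2))"
      by (intro is_form_mult is_form_diff 1 2 3)
    moreover have "is_form ((2 - b) + ((2 - a) + (2 - c))) (B1 * (A2 * C3 - A3 * C2))"
      by (intro is_form_mult is_form_diff 1 2 3)
    moreover have "is_form ((2 - c) + ((2 - a) + (2 - b))) (C1 * (A2 * B3 - A3 * B2))"
      by (intro is_form_mult is_form_diff 1 2 3)
    moreover have "(2 - a) + ((2 - b) + (2 - c)) = 4" "(2 - b) + ((2 - a) + (2 - c)) = 4"
      "(2 - c) + ((2 - a) + (2 - b)) = 4" using deg by auto
    ultimately have "is_form 4 H" unfolding H by (auto intro!: is_form_add is_form_diff)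
    moreover have "det3 (teval A1 x y z, teval B1 x y z, teval C1 x y z)
        (teval A2 x y z, teval B2 x y z, teval C2 x y z) (teval A3 x y z, teval B3 x y z, teval C3 x y z) = 0"
      using nz zeros[unfolded 1(5) 2(5) 3(5)]
      by (intro det3_eq_0[of "x ^ (a + 1)" "y ^ (b + 1)" "z ^ (c + 1)"]) auto
    then have "teval H x y z = 0" unfolding H by (simp add: det3_def)
    ultimately show ?thesis by blast
  qed
qed

text \<open>The values of the quartic monomials at a common zero form a nonzero vector that is annihilated by
Sylvester's matrix.\<close>
lemma resultant_cubics_eq_0:
  assumes forms: "is_form 3 G1" "is_form 3 G2" "is_form 3 G3"
    and zeros: "teval G1 x y z = 0" "teval G2 x y z = 0" "teval G3 x y z = 0"
    and nz: "(x, y, z) \<noteq> (0, 0, 0)"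
  shows "resultant_cubics G1 G2 G3 = 0"
proof -
  define S where "S = sylvester_forms G1 G2 G3"
  define ms where "ms = monomials 4"
  define M where "M = mat_of_rows_list 15 (map (\<lambda>H. map (tcoeff H) ms) S)"
  define v where "v = vec 15 (\<lambda>j. teval (tmonom 1 (ms ! j)) x y z)"
  have len: "length S = 15" "length ms = 15"
    unfolding S_def ms_def sylvester_forms_def monomials_1 monomials_2 monomials_4 by simp_all
  have dims: "M \<in> carrier_mat 15 15" "v \<in> carrier_vec 15"
    unfolding M_def v_def mat_of_rows_list_def by (simp_all add: len)
  have "M *\<^sub>v v = 0\<^sub>v 15"
  proof (rule eq_vecI)
    fix i assume "i < dim_vec (0\<^sub>v 15 :: rat vec)"
    then have i: "i < 15" by simp
    define H where "H = S ! i"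
    have "H \<in> set S" unfolding H_def using i len by simp
    then have H: "is_form 4 H" "teval H x y z = 0"
      using sylvester_forms_at_zero[OF forms zeros nz, of H] unfolding S_def by auto
    have entry: "M $$ (i, j) = tcoeff H (ms ! j)" if "j < 15" for j
      unfolding M_def mat_of_rows_list_def H_def using i that by (simp add: len)
    have "(M *\<^sub>v v) $ i = (\<Sum>j = 0..<15. M $$ (i, j) * v $ j)"
      using i dims by (simp add: scalar_prod_def)
    also have "\<dots> = (\<Sum>j = 0..<15. tcoeff H (ms ! j) * teval (tmonom 1 (ms ! j)) x y z)"
      by (intro sum.cong refl) (simp add: entry v_def)
    also have "\<dots> = (\<Sum>m\<leftarrow>ms. tcoeff H m * teval (tmonom 1 m) x y z)"
      by (simp add: sum_list_sum_nth len)
    also have "\<dots> = 0" unfolding ms_def using teval_form[OF H(1)] H(2) by simp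
    finally show "(M *\<^sub>v v) $ i = 0\<^sub>v 15 $ i" using i by simp
  qed (use dims in simp)
  moreover have "v \<noteq> 0\<^sub>v 15"
  proof
    assume *: "v = 0\<^sub>v 15"
    have "teval (tmonom 1 (ms ! j)) x y z = 0" if "j < 15" for j
      using that arg_cong[OF *, of "\<lambda>v. vec_index v j"] by (simp add: v_def)
    from this[of 0] this[of 4] this[of 14] show False
      using nz unfolding ms_def monomials_4 by simp
  qed
  ultimately have "det M = 0"
    using det_0_iff_vec_prod_zero[OF dims(1)] dims(2) by blast
  then show ?thesis unfolding resultant_cubics_def M_def S_def ms_def .
qed

section \<open>Divisors of forms and torsion classes\<close>

text \<open>The curve is smooth at the rational point \<open>p\<close> and \<open>T\<close> gives a local parameter: modulo \<open>F\<close> and up to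
a unit, the second linear equation \<open>N\<close> of the point is a multiple of \<open>T\<close>.\<close>
definition smooth_with :: "tpoly \<Rightarrow> tpoly set \<Rightarrow> tpoly \<Rightarrow> bool" where
  "smooth_with F p T \<longleftrightarrow> (\<exists>N W V U e. linear_frame T N W \<and> T \<in> p \<and> N \<in> p \<and> W \<notin> p \<and>
     is_form e V \<and> is_form e U \<and> V \<notin> p \<and> F dvd V * N - U * T)"

text \<open>The function \<open>E\<close> is the divisor of the form \<open>H\<close> on the curve. The local parameters \<open>\<tau>\<close> are fixed
once for all forms, because orders are compared with respect to the same parameter. Where \<open>H\<close> does
not vanish no parameter is asked for, so smoothness is required at the zeros of \<open>H\<close> only.\<close>
definition form_divisor :: "tpoly \<Rightarrow> (tpoly set \<Rightarrow> tpoly) \<Rightarrow> nat \<Rightarrow> tpoly \<Rightarrow> (tpoly set \<Rightarrow> nat) \<Rightarrow> bool" where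
  "form_divisor F \<tau> d H E \<longleftrightarrow> is_form d H \<and> \<not> F dvd H \<and>
     (\<forall>p\<in>closed_points F. E p = 0 \<and> H \<notin> p \<or> smooth_with F p (\<tau> p) \<and> local_order F p (\<tau> p) d H (E p))"

lemma form_divisorD:
  assumes "form_divisor F \<tau> d H E"
  shows "is_form d H" "\<not> F dvd H"
    "p \<in> closed_points F \<Longrightarrow> E p = 0 \<and> H \<notin> p \<or> smooth_with F p (\<tau> p) \<and> local_order F p (\<tau> p) d H (E p)"
  using assms unfolding form_divisor_def by auto

lemma form_divisor_cong:
  "form_divisor F \<tau> d H E \<Longrightarrow> d = d' \<Longrightarrow> (\<And>p. E p = E' p) \<Longrightarrow> form_divisor F \<tau> d' H E'"
  by (simp add: form_divisor_def)

lemma form_divisor_order: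
  assumes "form_divisor F \<tau> d H E" "p \<in> closed_points F"
  shows "local_order F p (\<tau> p) d H (E p)"
  using form_divisorD[OF assms(1)] assms(2) local_order_unit[OF closed_pointsD(3)[OF assms(2)]]
  by metis

lemma form_divisor_mult:
  assumes F: "prime_elem F" and H: "form_divisor F \<tau> d H E" and H': "form_divisor F \<tau> d' H' E'"
  shows "form_divisor F \<tau> (d + d') (H * H') (\<lambda>p. E p + E' p)"
  unfolding form_divisor_def
proof (intro conjI ballI)
  fix p assume p: "p \<in> closed_points F"
  have "local_order F p (\<tau> p) (d + d') (H * H') (E p + E' p)"
    using local_order_mult[OF closed_pointsD(3)[OF p]] form_divisor_order[OF H p] form_divisor_order[OF H' p] by blast
  then show "E p + E' p = 0 \<and> H * H' \<notin> p \<or>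
      smooth_with F p (\<tau> p) \<and> local_order F p (\<tau> p) (d + d') (H * H') (E p + E' p)"
    using form_divisorD(3)[OF H p] form_divisorD(3)[OF H' p] primeideal_of_typeD(3)[OF closed_pointsD(3)[OF p]]
    by auto
qed (use F form_divisorD[OF H] form_divisorD[OF H'] in \<open>auto simp: prime_elem_dvd_mult_iff intro: is_form_mult\<close>)

lemma form_divisor_1:
  assumes F: "prime_elem F"
  shows "form_divisor F \<tau> 0 1 (\<lambda>p. 0)"
  using F primeideal_of_typeD(2)[OF closed_pointsD(3)] unfolding form_divisor_def prime_elem_def by auto

lemma form_divisor_power:
  assumes F: "prime_elem F" and H: "form_divisor F \<tau> d H E"
  shows "form_divisor F \<tau> (n * d) (H ^ n) (\<lambda>p. n * E p)"
proof (induction n)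
  case 0
  then show ?case using form_divisor_1[OF F] by simp
next
  case (Suc n)
  then show ?case using form_divisor_mult[OF F H Suc] by simp
qed

lemma has_ord_form_divisor:
  assumes F: "prime_elem F" and H: "form_divisor F \<tau> d H E" and H': "form_divisor F \<tau> d H' E'"
    and p: "p \<in> closed_points F"
  shows "has_ord F p (restrict_fun F (to_fract H / to_fract H')) (int (E p) - int (E' p))"
proof (cases "smooth_with F p (\<tau> p)")
  case True
  then obtain N W V U e where *: "linear_frame (\<tau> p) N W" "\<tau> p \<in> p" "N \<in> p" "W \<notin> p"
    "is_form e V" "is_form e U" "V \<notin> p" "F dvd V * N - U * \<tau> p"
    unfolding smooth_with_def by blast
  show ?thesis
    by (rule has_ord_quotient[OF F closed_pointsD(3,2)[OF p] * form_divisor_order[OF H p]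
          form_divisor_order[OF H' p] form_divisorD(2)[OF H']])
next
  case False
  then have "E p = 0" "E' p = 0" "H \<notin> p" "H' \<notin> p"
    using form_divisorD(3)[OF H p] form_divisorD(3)[OF H' p] by auto
  then show ?thesis
    using has_ord_0[OF F closed_pointsD(3,2)[OF p] form_divisorD(1)[OF H] form_divisorD(1)[OF H']] by simp
qed

lemma torsion_classI:
  assumes F: "prime_elem F" and H: "form_divisor F \<tau> d H E" and H': "form_divisor F \<tau> d H' E'"
    and R: "R \<in> closed_points F" "R' \<in> closed_points F" and n: "n \<ge> 1"
    and eq: "\<And>p. p \<in> closed_points F \<Longrightarrow>
      int (E p) - int (E' p) = int n * ((if p = R then 1 else 0) - (if p = R' then 1 else 0))"
  shows "torsion_class F (frag_of R - frag_of R')"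
proof -
  let ?D = "frag_cmul (int n) (frag_of R - frag_of R')"
  let ?h = "restrict_fun F (to_fract H / to_fract H')"
  have lookup: "Poly_Mapping.lookup ?D p = int n * ((if p = R then 1 else 0) - (if p = R' then 1 else 0))" for p
    by (simp add: lookup_minus lookup_single when_def)
  have "Poly_Mapping.keys ?D \<subseteq> closed_points F"
    unfolding subset_iff in_keys_iff lookup using R by (auto split: if_splits)
  moreover have "has_ord F p ?h (Poly_Mapping.lookup ?D p)" if "p \<in> closed_points F" for p
    unfolding lookup eq[OF that, symmetric] by (rule has_ord_form_divisor[OF F H H' that])
  ultimately have "is_div_of F ?h ?D" unfolding is_div_of_def by blast
  moreover have "?h \<in> carrier (function_field F) - {\<zero>\<^bsub>function_field F\<^esub>}"
    using restrict_fun_nonzero[OF F form_divisorD(1)[OF H] form_divisorD(1)[OF H'] form_divisorD(2)[OF H]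
        form_divisorD(2)[OF H']] .
  ultimately show ?thesis
    unfolding torsion_class_def principal_divisors_def using n by blast
qed

section \<open>Irreducibility\<close>

text \<open>If \<open>q\<close> divides the constant coefficient of the factor \<open>g\<close> but not that of \<open>h\<close>, the first coefficient
of \<open>g\<close> not divisible by \<open>q\<close> has an index that cannot be smaller than the degree of \<open>f\<close>, so \<open>h\<close> is
constant.\<close>
lemma eisenstein:
  fixes f :: "'a :: idom poly"
  assumes q: "prime_elem q" and lead: "Polynomial.lead_coeff f = 1" and deg: "Polynomial.degree f > 0"
    and dvd: "\<And>i. i < Polynomial.degree f \<Longrightarrow> q dvd Polynomial.coeff f i"
    and const: "\<not> q ^ 2 dvd Polynomial.coeff f 0"
  shows "Factorial_Ring.irreducible f"
proof -
  have main: "h dvd 1" if f: "f = g * h" and g0: "q dvd Polynomial.coeff g 0" and h0: "\<not> q dvd Polynomial.coeff h 0" for g h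
  proof -
    have nz: "g \<noteq> 0" "h \<noteq> 0" using deg f by auto
    have lc: "Polynomial.lead_coeff g * Polynomial.lead_coeff h = 1" using lead f by (simp add: lead_coeff_mult)
    have "\<not> q dvd Polynomial.lead_coeff g"
      using lc q unfolding prime_elem_def by (metis dvd_mult2 dvd_trans one_dvd dvd_triv_left)
    then have ex: "\<exists>i. \<not> q dvd Polynomial.coeff g i" by blast
    define i where "i = (LEAST i. \<not> q dvd Polynomial.coeff g i)"
    have i: "\<not> q dvd Polynomial.coeff g i" unfolding i_def by (rule LeastI_ex[OF ex])
    have less: "q dvd Polynomial.coeff g j" if "j < i" for j
      using not_less_Least[of j "\<lambda>i. \<not> q dvd Polynomial.coeff g i"] that unfolding i_def by blast
    have "Polynomial.coeff f i = (\<Sum>j<i. Polynomial.coeff g j * Polynomial.coeff h (i - j)) + Polynomial.coeff g i * Polynomial.coeff h 0"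
      unfolding f coeff_mult by (simp add: lessThan_Suc_atMost[symmetric])
    moreover have "q dvd (\<Sum>j<i. Polynomial.coeff g j * Polynomial.coeff h (i - j))"
      by (intro dvd_sum dvd_mult2) (auto intro: less)
    moreover have "\<not> q dvd Polynomial.coeff g i * Polynomial.coeff h 0"
      using i h0 q prime_elem_dvd_mult_iff by blast
    ultimately have "\<not> q dvd Polynomial.coeff f i" using dvd_add_right_iff by metis
    then have "Polynomial.degree f \<le> i" using dvd not_less by blast
    moreover have "i \<le> Polynomial.degree g" using i by (intro le_degree) auto
    moreover have "Polynomial.degree f = Polynomial.degree g + Polynomial.degree h"
      unfolding f using nz by (rule degree_mult_eq)
    ultimately have "Polynomial.degree h = 0" by simp
    then obtain x where h: "h = [:x:]" by (rule degree_eq_zeroE)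
    have "x dvd 1" using lc h by (metis dvd_triv_right lead_coeff_pCons(2))
    then show ?thesis unfolding h by (simp add: is_unit_const_poly_iff)
  qed
  show ?thesis
  proof (rule Factorial_Ring.irreducibleI)
    show "f \<noteq> 0" using deg by auto
    show "\<not> f dvd 1" using deg by (auto simp: is_unit_poly_iff)
    fix g h assume f: "f = g * h"
    have f0: "Polynomial.coeff f 0 = Polynomial.coeff g 0 * Polynomial.coeff h 0"
      unfolding f by (simp add: coeff_mult)
    have "q dvd Polynomial.coeff g 0 * Polynomial.coeff h 0" using dvd[OF deg] unfolding f0 .
    moreover have "\<not> (q dvd Polynomial.coeff g 0 \<and> q dvd Polynomial.coeff h 0)"
      using const unfolding f0 power2_eq_square by (auto intro: mult_dvd_mono)
    ultimately show "g dvd 1 \<or> h dvd 1"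
      using main[of g h] main[of h g] f prime_elem_dvd_mult_iff[OF q] by (auto simp: mult.commute)
  qed
qed

text \<open>A curve that meets the line \<open>Z = 0\<close> in the single smooth point \<open>(0:1:0)\<close> is irreducible, by
Eisenstein's criterion in \<open>\<rat>[Z][Y][X]\<close> at the prime \<open>Z\<close>. The constant coefficient is divisible by \<open>Z\<close>
exactly once because \<open>V\<close> does not vanish at the point.\<close>
lemma prime_elem_hyperflex:
  assumes F: "F = tX ^ Suc n + tZ * V" and V: "is_form n V" and "teval V 0 1 0 \<noteq> 0"
  shows "prime_elem F"
proof -
  define q :: "rat poly poly" where "q = [:[:0, 1:]:]"
  have q: "prime_elem q"
    using prime_elem_linear_field_poly[of 1 "0 :: rat"] by (simp add: q_def prime_elem_const_poly_iff)
  have tX: "tX = Polynomial.monom 1 1"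
    unfolding tX_def tmonom_def by (simp add: one_pCons monom_0)
  have X: "tX ^ Suc n = Polynomial.monom 1 (Suc n)"
    unfolding tX monom_power by simp
  have Z: "tZ = [:q:]"
    unfolding tZ_def tmonom_def q_def by (simp add: monom_0 monom_Suc)
  have coeff: "Polynomial.coeff F i = (if i = Suc n then 1 else 0) + q * Polynomial.coeff V i" for i
    unfolding F X Z by simp
  have V0: "Polynomial.coeff V i = 0" if "i > n" for i
  proof -
    have "tcoeff V (i, j, k) = 0" for j k
      using V that unfolding is_form_iff by fastforce
    then show ?thesis by (auto simp: tcoeff_def poly_eq_iff)
  qed
  have deg: "Polynomial.degree F = Suc n"
  proof (rule antisym)
    show "Polynomial.degree F \<le> Suc n" by (rule degree_le) (auto simp: coeff V0)
    show "Suc n \<le> Polynomial.degree F" by (rule le_degree) (simp add: coeff V0)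
  qed
  have "\<not> q ^ 2 dvd Polynomial.coeff F 0"
  proof
    assume "q ^ 2 dvd Polynomial.coeff F 0"
    then have "q * q dvd q * Polynomial.coeff V 0" unfolding coeff power2_eq_square by simp
    then have "q dvd Polynomial.coeff V 0" using q by (auto simp: prime_elem_def)
    then obtain w where "poly V 0 = q * w" by (auto simp: poly_0_coeff_0 elim: dvdE)
    then have "teval V 0 1 0 = 0" unfolding teval_def by (simp add: q_def)
    then show False using assms(3) by simp
  qed
  then have "Factorial_Ring.irreducible F"
    by (intro eisenstein[OF q]) (auto simp: deg coeff V0)
  then show ?thesis by (rule irreducible_imp_prime_elem)
qed

section \<open>The family of quartics\<close>

lemma tconst_hom:
  "tconst (r + s) = tconst r + tconst s" "tconst (r - s) = tconst r - tconst s"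
  "tconst (- r) = - tconst r" "tconst (r * s) = tconst r * tconst s"
  "tconst (r ^ n) = tconst r ^ n" "tconst (numeral k) = numeral k"
proof -
  show add: "tconst (r + s) = tconst r + tconst s" for r s by (rule tmonom_add)
  show minus: "tconst (- r) = - tconst r" for r by (rule tmonom_uminus)
  show "tconst (r - s) = tconst r - tconst s" using add[of r "- s"] minus[of s] by simp
  show mult: "tconst (r * s) = tconst r * tconst s" for r s by (simp add: tconst_mult)
  show "tconst (r ^ n) = tconst r ^ n" by (induction n) (simp_all add: mult)
  show "tconst (numeral k) = numeral k" by (simp add: tmonom_def monom_0 numeral_poly)
qed

lemma tmonom_eq: "tmonom r (i, j, k) = tconst r * tX ^ i * tY ^ j * tZ ^ k"
proof -
  have "tX ^ i = tmonom 1 (i, 0, 0)" for i by (induction i) (simp_all add: tX_def tmonom_mult)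
  moreover have "tY ^ i = tmonom 1 (0, i, 0)" for i by (induction i) (simp_all add: tY_def tmonom_mult)
  moreover have "tZ ^ i = tmonom 1 (0, 0, i)" for i by (induction i) (simp_all add: tZ_def tmonom_mult)
  ultimately show ?thesis by (simp add: tmonom_mult)
qed

lemma dX_simps: "dX (A + B) = dX A + dX B" "dX (tmonom r (i, j, k)) = tmonom (of_nat i * r) (i - 1, j, k)"
  and dY_simps: "dY (A + B) = dY A + dY B" "dY (tmonom r (i, j, k)) = tmonom (of_nat j * r) (i, j - 1, k)"
  and dZ_simps: "dZ (A + B) = dZ A + dZ B" "dZ (tmonom r (i, j, k)) = tmonom (of_nat k * r) (i, j, k - 1)"
proof -
  have of_nat: "of_nat n * Polynomial.monom c m = Polynomial.monom (of_nat n * c) m"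
    for n m and c :: "'a :: comm_ring_1"
    by (simp add: of_nat_poly smult_monom)
  show "dX (A + B) = dX A + dX B" by (simp add: dX_def pderiv_add)
  show "dY (A + B) = dY A + dY B"
    by (rule poly_eqI) (simp add: dY_def coeff_map_poly pderiv_add)
  show "dZ (A + B) = dZ A + dZ B"
    by (rule poly_eqI, rule poly_eqI) (simp add: dZ_def coeff_map_poly pderiv_add)
  show "dX (tmonom r (i, j, k)) = tmonom (of_nat i * r) (i - 1, j, k)"
    by (simp add: dX_def tmonom_def pderiv_monom of_nat)
  show "dY (tmonom r (i, j, k)) = tmonom (of_nat j * r) (i, j - 1, k)"
    by (simp add: dY_def tmonom_def pderiv_monom of_nat map_poly_monom)
  show "dZ (tmonom r (i, j, k)) = tmonom (of_nat k * r) (i, j, k - 1)"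
    by (simp add: dZ_def tmonom_def pderiv_monom of_nat map_poly_monom)
qed

definition quartic :: "rat \<Rightarrow> rat \<Rightarrow> rat \<Rightarrow> tpoly" where
  "quartic a b c = tmonom 1 (4, 0, 0) + tmonom 1 (0, 3, 1)
     + tmonom (3 * a ^ 4 - a ^ 3 * c) (0, 2, 2) + tmonom c (1, 2, 1)
     + tmonom (a ^ 6 * b ^ 6) (0, 1, 3) + tmonom (a ^ 3 * b ^ 3 * c) (1, 1, 2)
     + tmonom (3 * a ^ 2 - b ^ 6 - b ^ 3 * c) (2, 1, 1)"

lemma coeff_pCons_numeral:
  "Polynomial.coeff (pCons a p) (numeral k) = Polynomial.coeff p (pred_numeral k)"
  by (simp add: numeral_eq_Suc)

lemma homogenize_quartic:
  "homogenize 4 [:Polynomial.monom 1 4, [:a ^ 6 * b ^ 6, a ^ 3 * b ^ 3 * c, 3 * a ^ 2 - b ^ 6 - b ^ 3 * c:],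
     [:3 * a ^ 4 - a ^ 3 * c, c:], 1:] = quartic a b c"
  unfolding homogenize_def monomials_4 quartic_def by (simp add: coeff_pCons_numeral add_ac)

lemma homogenize_line:
  "homogenize 1 [:[:r, s:], [:t:]:] = tconst s * tX + tconst t * tY + tconst r * tZ"
  by (simp add: homogenize_def monomials_1[simplified] tX_def tY_def tZ_def tmonom_mult add_ac)

lemma is_form_quartic: "is_form 4 (quartic a b c)"
  unfolding quartic_def by (intro is_form_add is_form_tmonom) simp_all

lemma is_form_gradient:
  "is_form 3 (dX (quartic a b c))" "is_form 3 (dY (quartic a b c))" "is_form 3 (dZ (quartic a b c))"
  unfolding quartic_def dX_simps dY_simps dZ_simps
  by (simp_all, (intro is_form_add is_form_tmonom; simp)+)

text \<open>With the constants also written as ring elements, the factorizations below become identities that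
hold in every commutative ring.\<close>
lemma quartic_eq:
  fixes a b c :: rat
  defines "A \<equiv> tconst a" and "B \<equiv> tconst b" and "G \<equiv> tconst c"
  shows "quartic a b c = tX ^ 4 + tY ^ 3 * tZ + (3 * A ^ 4 - A ^ 3 * G) * tY ^ 2 * tZ ^ 2 + G * tX * tY ^ 2 * tZ
     + A ^ 6 * B ^ 6 * tY * tZ ^ 3 + A ^ 3 * B ^ 3 * G * tX * tY * tZ ^ 2
     + (3 * A ^ 2 - B ^ 6 - B ^ 3 * G) * tX ^ 2 * tY * tZ"
  unfolding quartic_def A_def B_def G_def tconst_hom[symmetric]
    tmonom_eq[of _ 4 0 0] tmonom_eq[of _ 0 3 1] tmonom_eq[of _ 0 2 2] tmonom_eq[of _ 1 2 1]
    tmonom_eq[of _ 0 1 3] tmonom_eq[of _ 1 1 2] tmonom_eq[of _ 2 1 1]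
  by simp

definition cofactor_Z :: "rat \<Rightarrow> rat \<Rightarrow> rat \<Rightarrow> tpoly" where
  "cofactor_Z a b c = tY ^ 3 + tconst (3 * a ^ 4 - a ^ 3 * c) * (tY ^ 2 * tZ) + tconst c * (tX * tY ^ 2)
     + tconst (a ^ 6 * b ^ 6) * (tY * tZ ^ 2) + tconst (a ^ 3 * b ^ 3 * c) * (tX * tY * tZ)
     + tconst (3 * a ^ 2 - b ^ 6 - b ^ 3 * c) * (tX ^ 2 * tY)"

definition cofactor_Y :: "rat \<Rightarrow> rat \<Rightarrow> rat \<Rightarrow> tpoly" where
  "cofactor_Y a b c = tY ^ 2 * tZ + tconst (3 * a ^ 4 - a ^ 3 * c) * (tY * tZ ^ 2) + tconst c * (tX * tY * tZ)
     + tconst (a ^ 6 * b ^ 6) * tZ ^ 3 + tconst (a ^ 3 * b ^ 3 * c) * (tX * tZ ^ 2)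
     + tconst (3 * a ^ 2 - b ^ 6 - b ^ 3 * c) * (tX ^ 2 * tZ)"

text \<open>The quotient of \<open>C - Z T^3\<close> by \<open>N\<close>, in the notation of the introduction.\<close>
definition cofactor_P :: "rat \<Rightarrow> rat \<Rightarrow> rat \<Rightarrow> tpoly" where
  "cofactor_P a b c = tX ^ 3 + tconst (a ^ 3) * (tX ^ 2 * tZ) + tconst (a ^ 6) * (tX * tZ ^ 2) + tconst (a ^ 9) * tZ ^ 3
     + tconst c * (tY ^ 2 * tZ) + tconst (3 * a ^ 2 - b ^ 6 - b ^ 3 * c) * (tX * tY * tZ)
     + tconst (3 * a ^ 5 - a ^ 3 * b ^ 6) * (tY * tZ ^ 2)"

text \<open>The quotient of \<open>C - X T'^3\<close> by \<open>M\<close>, in the notation of the introduction.\<close>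
definition cofactor_Q :: "rat \<Rightarrow> rat \<Rightarrow> rat \<Rightarrow> tpoly" where
  "cofactor_Q a b c = tY ^ 2 * tZ + tconst (3 * a ^ 4 - a ^ 3 * c) * (tY * tZ ^ 2)
     + tconst (c + b ^ 3) * (tX * tY * tZ)
     + tconst (a ^ 6 * b ^ 6) * tZ ^ 3 + tconst (3 * a ^ 4 * b ^ 3) * (tX * tZ ^ 2)
     + tconst (3 * a ^ 2) * (tX ^ 2 * tZ)"

abbreviation line_P :: "rat \<Rightarrow> tpoly" where "line_P a \<equiv> tX - tconst (a ^ 3) * tZ"
abbreviation line_Q :: "rat \<Rightarrow> tpoly" where "line_Q b \<equiv> tY - tconst (b ^ 3) * tX"
abbreviation param_P :: "rat \<Rightarrow> tpoly" where "param_P a \<equiv> tY + tconst (a ^ 4) * tZ"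
abbreviation param_Q :: "rat \<Rightarrow> rat \<Rightarrow> tpoly" where "param_Q a b \<equiv> tX + tconst (a ^ 2 * b ^ 3) * tZ"

lemma quartic_Z: "quartic a b c = tZ * cofactor_Z a b c + tX ^ 4"
  unfolding quartic_eq cofactor_Z_def tconst_hom by (simp add: algebra_simps power_numeral_reduce)

lemma quartic_Y: "quartic a b c = tY * cofactor_Y a b c + tX ^ 4"
  unfolding quartic_eq cofactor_Y_def tconst_hom by (simp add: algebra_simps power_numeral_reduce)

lemma quartic_P: "quartic a b c = line_P a * cofactor_P a b c + tZ * param_P a ^ 3"
  unfolding quartic_eq cofactor_P_def tconst_hom by (simp add: algebra_simps power_numeral_reduce)

lemma quartic_Q: "quartic a b c = line_Q b * cofactor_Q a b c + tX * param_Q a b ^ 3"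
  unfolding quartic_eq cofactor_Q_def tconst_hom by (simp add: algebra_simps power_numeral_reduce)

lemma is_form_cofactor:
  "is_form 3 (cofactor_Z a b c)" "is_form 3 (cofactor_Y a b c)"
  "is_form 3 (cofactor_P a b c)" "is_form 3 (cofactor_Q a b c)"
proof -
  have *: "is_form (Suc 0 * n) (tX ^ n)" "is_form (Suc 0 * n) (tY ^ n)" "is_form (Suc 0 * n) (tZ ^ n)" for n
    using is_form_power[of 1 _ n] by (simp_all add: mult.commute)
  have mono: "is_form 3 (tX ^ i * tY ^ j * tZ ^ k)" if "i + j + k = 3" for i j k
    using is_form_mult[OF is_form_mult[OF *(1)[of i] *(2)[of j]] *(3)[of k]] that by simp
  note m = mono[of 3 0 0] mono[of 0 3 0] mono[of 0 0 3] mono[of 2 1 0] mono[of 2 0 1] mono[of 1 2 0]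
    mono[of 0 2 1] mono[of 1 0 2] mono[of 0 1 2] mono[of 1 1 1]
  show "is_form 3 (cofactor_Z a b c)" "is_form 3 (cofactor_Y a b c)"
    "is_form 3 (cofactor_P a b c)" "is_form 3 (cofactor_Q a b c)"
    unfolding cofactor_Z_def cofactor_Y_def cofactor_P_def cofactor_Q_def
    using m by (auto intro!: is_form_add is_form_cmult simp: mult.assoc)
qed

lemma teval_cofactors:
  "teval (cofactor_Z a b c) 0 1 0 = 1"
  "teval (cofactor_Y a b c) 0 0 1 = a ^ 6 * b ^ 6"
  by (simp_all add: cofactor_Z_def cofactor_Y_def)

lemma teval_cofactor_P:
  "teval (cofactor_P a b c) (a ^ 3) (- (a ^ 4)) 1 = a ^ 7 * ((a + b ^ 3) * (c + 2 * (b ^ 3 - a)))"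
  unfolding cofactor_P_def by (simp add: algebra_simps power_numeral_reduce)

text \<open>Differentiating \<open>C = N V\<^sub>P + Z T^3\<close> at a zero of \<open>N\<close> and \<open>T\<close> leaves \<open>V\<^sub>P\<close> times the coefficients of \<open>N\<close>.\<close>
lemma gradient_P:
  "teval (dX (quartic a b c)) (a ^ 3) (- (a ^ 4)) 1 = teval (cofactor_P a b c) (a ^ 3) (- (a ^ 4)) 1"
  "teval (dY (quartic a b c)) (a ^ 3) (- (a ^ 4)) 1 = 0"
  "teval (dZ (quartic a b c)) (a ^ 3) (- (a ^ 4)) 1 = - (a ^ 3) * teval (cofactor_P a b c) (a ^ 3) (- (a ^ 4)) 1"
  unfolding quartic_def dX_simps dY_simps dZ_simps cofactor_P_def
  by (simp_all add: algebra_simps power_numeral_reduce)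

lemma gradient_Q:
  fixes a b :: rat
  defines "x \<equiv> - (a ^ 2 * b ^ 3)" and "y \<equiv> - (a ^ 2 * b ^ 6)"
  shows "teval (dX (quartic a b c)) x y 1 = - (b ^ 3) * teval (cofactor_Q a b c) x y 1"
  "teval (dY (quartic a b c)) x y 1 = teval (cofactor_Q a b c) x y 1"
  "teval (dZ (quartic a b c)) x y 1 = 0"
  unfolding quartic_def dX_simps dY_simps dZ_simps cofactor_Q_def x_def y_def
  by (simp_all add: algebra_simps power_numeral_reduce)

section \<open>Points and divisors on the quartic\<close>

lemma linear_frame_coordinates:
  "linear_frame tX tZ tY" "linear_frame tX tY tZ"
proof -
  show "linear_frame tX tZ tY"
    by (rule linear_frameI[of _ _ _ 1 0 0 0 0 1 0 1 0]) simp_all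
  show "linear_frame tX tY tZ"
    by (rule linear_frameI[of _ _ _ 1 0 0 0 1 0 0 0 1]) simp_all
qed

lemma is_form_lines [simp]:
  "is_form (Suc 0) (line_P a)" "is_form (Suc 0) (line_Q b)" "is_form (Suc 0) (param_P a)" "is_form (Suc 0) (param_Q a b)"
  by (auto intro!: is_form_add is_form_diff is_form_cmult)

lemma linear_frame_P: "linear_frame (param_P a) (line_P a) tZ"
proof (rule linear_frameI)
  show "tX = tconst 0 * param_P a + tconst 1 * line_P a + tconst (a ^ 3) * tZ"
    and "tY = tconst 1 * param_P a + tconst 0 * line_P a + tconst (- (a ^ 4)) * tZ"
    and "tZ = tconst 0 * param_P a + tconst 0 * line_P a + tconst 1 * tZ"
    by (simp_all add: tconst_hom)
qed simp_all

lemma linear_frame_Q: "linear_frame (param_Q a b) (line_Q b) tZ"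
proof (rule linear_frameI)
  show "tX = tconst 1 * param_Q a b + tconst 0 * line_Q b + tconst (- (a ^ 2 * b ^ 3)) * tZ"
    and "tY = tconst (b ^ 3) * param_Q a b + tconst 1 * line_Q b + tconst (- (a ^ 2 * b ^ 6)) * tZ"
    and "tZ = tconst 0 * param_Q a b + tconst 0 * line_Q b + tconst 1 * tZ"
    by (simp_all add: tconst_hom algebra_simps power_numeral_reduce)
qed simp_all

text \<open>The lines \<open>X = 0\<close> and \<open>M = 0\<close> also cut out the origin.\<close>
lemma linear_frame_Q_origin: "linear_frame tX (line_Q b) tZ"
proof (rule linear_frameI)
  show "tX = tconst 1 * tX + tconst 0 * line_Q b + tconst 0 * tZ"
    and "tY = tconst (b ^ 3) * tX + tconst 1 * line_Q b + tconst 0 * tZ"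
    and "tZ = tconst 0 * tX + tconst 0 * line_Q b + tconst 1 * tZ"
    by simp_all
qed simp_all

text \<open>Divisibility by \<open>N\<close>, a monic linear polynomial in \<open>X\<close>, is vanishing at its root, and \<open>T\<close> does not vanish
there.\<close>
lemma line_P_cancel: "line_P a dvd param_P a * A \<Longrightarrow> line_P a dvd A"
proof -
  let ?r = "poly (tconst (a ^ 3) * tZ) 0"
  have L: "line_P a = [:- ?r, 1:]"
    by (simp add: tX_def tZ_def tmonom_def monom_0 monom_Suc one_pCons)
  have T: "poly (param_P a) ?r \<noteq> 0"
    by (simp add: tY_def tZ_def tmonom_def monom_0 monom_Suc one_pCons)
  show "line_P a dvd param_P a * A \<Longrightarrow> line_P a dvd A"
    unfolding L poly_eq_0_iff_dvd[symmetric] using T by simp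
qed

lemma line_Q_cancel:
  assumes "b \<noteq> 0"
  shows "line_Q b dvd param_Q a b * A \<Longrightarrow> line_Q b dvd A"
proof -
  (* the multiple of M that is monic in X *)
  define s where "s = 1 / b ^ 3"
  let ?r = "poly (tconst s * tY) 0"
  have unit: "tconst (- s) * tconst (- (b ^ 3)) = 1"
    using assms by (simp add: tconst_mult s_def)
  have L: "tconst (- s) * line_Q b = [:- ?r, 1:]"
    using assms
    by (simp add: tX_def tY_def tmonom_def monom_0 monom_Suc one_pCons s_def)
  have T: "poly (param_Q a b) ?r \<noteq> 0"
    using assms by (simp add: tX_def tY_def tZ_def tmonom_def monom_0 monom_Suc one_pCons s_def)
  have dvd: "line_Q b dvd B \<longleftrightarrow> [:- ?r, 1:] dvd B" for B
    unfolding L[symmetric] using unit by (simp add: dvd_mult_unit_iff mult_unit_dvd_iff' dvdI[of 1])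
  show "line_Q b dvd param_Q a b * A \<Longrightarrow> line_Q b dvd A"
    unfolding dvd poly_eq_0_iff_dvd[symmetric] using T by simp
qed

lemma mem_proj_point_linear [simp]:
  "tX \<in> proj_point x y z \<longleftrightarrow> x = 0" "tY \<in> proj_point x y z \<longleftrightarrow> y = 0" "tZ \<in> proj_point x y z \<longleftrightarrow> z = 0"
  "line_P a \<in> proj_point x y z \<longleftrightarrow> x = a ^ 3 * z" "line_Q b \<in> proj_point x y z \<longleftrightarrow> y = b ^ 3 * x"
  "param_P a \<in> proj_point x y z \<longleftrightarrow> y = - (a ^ 4 * z)" "param_Q a b \<in> proj_point x y z \<longleftrightarrow> x = - (a ^ 2 * b ^ 3 * z)"
  using mem_proj_point_iff[of 1 tX] mem_proj_point_iff[of 1 tY] mem_proj_point_iff[of 1 tZ]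
    mem_proj_point_iff[of 1 "line_P a"] mem_proj_point_iff[of 1 "line_Q b"]
    mem_proj_point_iff[of 1 "param_P a"] mem_proj_point_iff[of 1 "param_Q a b"]
  by (simp_all add: eq_neg_iff_add_eq_0)

lemma mem_proj_point_cofactor [simp]:
  "cofactor_Z a b c \<in> proj_point x y z \<longleftrightarrow> teval (cofactor_Z a b c) x y z = 0"
  "cofactor_Y a b c \<in> proj_point x y z \<longleftrightarrow> teval (cofactor_Y a b c) x y z = 0"
  "cofactor_P a b c \<in> proj_point x y z \<longleftrightarrow> teval (cofactor_P a b c) x y z = 0"
  "cofactor_Q a b c \<in> proj_point x y z \<longleftrightarrow> teval (cofactor_Q a b c) x y z = 0"
  "quartic a b c \<in> proj_point x y z \<longleftrightarrow> teval (quartic a b c) x y z = 0"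
  by (rule mem_proj_point_iff[OF is_form_cofactor(1)] mem_proj_point_iff[OF is_form_cofactor(2)]
      mem_proj_point_iff[OF is_form_cofactor(3)] mem_proj_point_iff[OF is_form_cofactor(4)]
      mem_proj_point_iff[OF is_form_quartic])+

lemma prime_elem_quartic: "prime_elem (quartic a b c)"
proof (rule prime_elem_hyperflex)
  show "quartic a b c = tX ^ Suc 3 + tZ * cofactor_Z a b c"
    unfolding quartic_Z Suc_numeral by (simp only: add.commute Num.add_num_simps)
qed (simp_all add: is_form_cofactor teval_cofactors)

text \<open>The expansion of \<open>F\<close> along the line \<open>N = 0\<close> gives \<open>V N \<equiv> - (D T^n) T\<close> modulo \<open>F\<close>, where \<open>V\<close> is a
unit at \<open>p\<close>.\<close>
lemma smooth_withI:
  assumes "F = N * V + D * T ^ Suc n" "linear_frame T N W" "p \<in> plane_points"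
    and "T \<in> p" "N \<in> p" "V \<notin> p" "is_form e V" "is_form e (D * T ^ n)"
  shows "smooth_with F p T"
proof -
  have "V * N - (- (D * T ^ n)) * T = F" using assms(1) by (simp add: algebra_simps)
  then have "F dvd V * N - (- (D * T ^ n)) * T" by simp
  then show ?thesis
    unfolding smooth_with_def
    using assms(2-7) frame_notin[OF assms(2-5)] is_form_uminus[OF assms(8)] by blast
qed

text \<open>Smoothness of \<open>C\<close> at \<open>P\<close> and at \<open>Q\<close>, in the form in which it follows from a nonzero discriminant.\<close>
locale smooth_quartic =
  fixes a b c :: rat
  assumes a: "a \<noteq> 0" and b: "b \<noteq> 0"
    and smooth_P: "teval (cofactor_P a b c) (a ^ 3) (- (a ^ 4)) 1 \<noteq> 0"
    and smooth_Q: "teval (cofactor_Q a b c) (- (a ^ 2 * b ^ 3)) (- (a ^ 2 * b ^ 6)) 1 \<noteq> 0"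
begin

abbreviation "C \<equiv> quartic a b c"
abbreviation "infty \<equiv> proj_point 0 1 0"
abbreviation "origin \<equiv> proj_point 0 0 1"
abbreviation "P \<equiv> proj_point (a ^ 3) (- (a ^ 4)) 1"
abbreviation "Q \<equiv> proj_point (- (a ^ 2 * b ^ 3)) (- (a ^ 2 * b ^ 6)) 1"

lemma sum_nonzero: "a + b ^ 3 \<noteq> 0"
  using smooth_P by (auto simp: teval_cofactor_P)

lemma line_Q_value: "b ^ 3 * (a ^ 2 * b ^ 3) = a ^ 2 * b ^ 6"
  by (simp add: mult.left_commute)

lemma teval_points [simp]:
  "teval C 0 1 0 = 0" "teval C 0 0 1 = 0" "teval C (a ^ 3) (- (a ^ 4)) 1 = 0"
  "teval C (- (a ^ 2 * b ^ 3)) (- (a ^ 2 * b ^ 6)) 1 = 0"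
proof -
  show "teval C 0 1 0 = 0" by (simp add: quartic_Z)
  show "teval C 0 0 1 = 0" by (simp add: quartic_Y)
  show "teval C (a ^ 3) (- (a ^ 4)) 1 = 0" by (simp add: quartic_P)
  show "teval C (- (a ^ 2 * b ^ 3)) (- (a ^ 2 * b ^ 6)) 1 = 0"
    by (simp add: quartic_Q line_Q_value)
qed

lemma points_plane [simp]:
  "infty \<in> plane_points" "origin \<in> plane_points" "P \<in> plane_points" "Q \<in> plane_points"
  by (rule proj_point_plane_point, simp)+

lemma Q_on_line [simp]: "line_Q b \<in> Q"
  by (simp add: line_Q_value)

lemma infty_closed:
  assumes "F \<in> infty" shows "infty \<in> closed_points F"
  by (rule closed_pointI[OF linear_frame_coordinates(1)]) (simp_all add: assms)

lemma origin_closed: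
  assumes "F \<in> origin" shows "origin \<in> closed_points F"
  by (rule closed_pointI[OF linear_frame_coordinates(2)]) (simp_all add: assms)

lemma P_closed:
  assumes "F \<in> P" shows "P \<in> closed_points F"
  by (rule closed_pointI[OF linear_frame_P]) (simp_all add: assms)

lemma Q_closed:
  assumes "F \<in> Q" shows "Q \<in> closed_points F"
  by (rule closed_pointI[OF linear_frame_Q[of a b]]) (use assms Q_on_line in simp_all)

lemma x_coordinates_differ: "- (a ^ 2 * b ^ 3) \<noteq> a ^ 3"
proof
  assume "- (a ^ 2 * b ^ 3) = a ^ 3"
  moreover have "a ^ 2 * (a + b ^ 3) = a ^ 3 + a ^ 2 * b ^ 3"
    by (simp add: distrib_left power2_eq_square power3_eq_cube)
  ultimately have "a ^ 2 * (a + b ^ 3) = 0" by simp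
  then show False using a sum_nonzero by simp
qed

lemma points_distinct [simp]:
  "infty \<noteq> origin" "infty \<noteq> P" "infty \<noteq> Q" "origin \<noteq> P" "origin \<noteq> Q" "P \<noteq> Q"
  "origin \<noteq> infty" "P \<noteq> infty" "Q \<noteq> infty" "P \<noteq> origin" "Q \<noteq> origin" "Q \<noteq> P"
proof -
  have neq: "p \<noteq> q" if "L \<in> p" "L \<notin> q" for L and p q :: "tpoly set" using that by blast
  have "line_P a \<notin> Q" using x_coordinates_differ by simp
  then have "P \<noteq> Q" by (intro neq[of "line_P a"]) auto
  moreover have "infty \<noteq> origin" "infty \<noteq> P" "infty \<noteq> Q" by (rule neq[of tZ]; simp)+
  moreover have "origin \<noteq> P" "origin \<noteq> Q" by (rule neq[of tX]; use a b in simp)+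
  ultimately show "infty \<noteq> origin" "infty \<noteq> P" "infty \<noteq> Q" "origin \<noteq> P" "origin \<noteq> Q" "P \<noteq> Q"
    "origin \<noteq> infty" "P \<noteq> infty" "Q \<noteq> infty" "P \<noteq> origin" "Q \<noteq> origin" "Q \<noteq> P"
    by blast+
qed

context
  fixes p :: "tpoly set"
  assumes p: "p \<in> plane_points" and Cp: "C \<in> p"
begin

lemma point_facts: "primeideal p tring"
  by (rule plane_pointsD(1)[OF p])

lemma summand_mem: "A * B + D \<in> p \<Longrightarrow> A \<in> p \<Longrightarrow> D \<in> p"
  using ideal_of_typeD(4,6)[OF primeideal_of_typeD(1)[OF point_facts], of A B] 
    ideal_of_typeD(6)[OF primeideal_of_typeD(1)[OF point_facts], of "A * B + D" "A * B"]
  by simp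

lemma meets_Z: "tZ \<in> p \<Longrightarrow> p = infty"
  using summand_mem[OF Cp[unfolded quartic_Z]] primeideal_of_typeD(4)[OF point_facts]
    plane_point_unique[OF linear_frame_coordinates(1) p _ _ points_plane(1)] by simp

lemma meets_Y: "tY \<in> p \<Longrightarrow> p = origin"
  using summand_mem[OF Cp[unfolded quartic_Y]] primeideal_of_typeD(4)[OF point_facts]
    plane_point_unique[OF linear_frame_coordinates(2) p _ _ points_plane(2)] by simp

lemma meets_line_P: "line_P a \<in> p \<Longrightarrow> p = P \<or> p = infty"
  using summand_mem[OF Cp[unfolded quartic_P]] primeideal_of_typeD(3,4)[OF point_facts] meets_Z
    plane_point_unique[OF linear_frame_P[of a] p _ _ points_plane(3)] by auto

lemma meets_line_Q: "line_Q b \<in> p \<Longrightarrow> p = Q \<or> p = origin"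
  using summand_mem[OF Cp[unfolded quartic_Q]] primeideal_of_typeD(3,4)[OF point_facts]
    plane_point_unique[OF linear_frame_Q[of a b] p _ _ points_plane(4)]
    plane_point_unique[OF linear_frame_Q_origin[of b] p _ _ points_plane(2)] Q_on_line by auto

end

lemma closed_points_line_P: "closed_points C \<inter> closed_points (line_P a) = {P, infty}"
proof (intro equalityI subsetI)
  fix p assume "p \<in> closed_points C \<inter> closed_points (line_P a)"
  then show "p \<in> {P, infty}" using meets_line_P closed_pointsD by blast
next
  fix p assume "p \<in> {P, infty}"
  then show "p \<in> closed_points C \<inter> closed_points (line_P a)"
    using infty_closed P_closed by auto
qed

lemma closed_points_line_Q: "closed_points C \<inter> closed_points (line_Q b) = {Q, origin}"
proof (intro equalityI subsetI)
  fix p assume "p \<in> closed_points C \<inter> closed_points (line_Q b)"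
  then show "p \<in> {Q, origin}" using meets_line_Q closed_pointsD by blast
next
  fix p assume "p \<in> {Q, origin}"
  then show "p \<in> closed_points C \<inter> closed_points (line_Q b)"
    using origin_closed Q_closed Q_on_line by auto
qed

lemma tangent_P: "is_tangent_line C P (line_P a)"
proof -
  let ?v = "teval (cofactor_P a b c) (a ^ 3) (- (a ^ 4)) 1"
  have "line_P a = tmonom (1 / ?v * ?v) (1, 0, 0) + tmonom (1 / ?v * 0) (0, 1, 0)
      + tmonom (1 / ?v * (- (a ^ 3) * ?v)) (0, 0, 1)"
    using smooth_P by (simp add: tX_def tZ_def tmonom_mult tmonom_uminus)
  moreover have "teval (line_P a) 0 0 1 \<noteq> 0" using a by simp
  then have "line_P a \<noteq> 0" by (metis teval_0)
  ultimately show ?thesis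
    unfolding is_tangent_line_def using smooth_P
    by (intro conjI exI[of _ "a ^ 3"] exI[of _ "- (a ^ 4)"] exI[of _ 1] exI[of _ "1 / ?v"])
       (simp_all only: gradient_P teval_points, simp_all)
qed

lemma tangent_Q: "is_tangent_line C Q (line_Q b)"
proof -
  let ?x = "- (a ^ 2 * b ^ 3)" and ?y = "- (a ^ 2 * b ^ 6)"
  let ?v = "teval (cofactor_Q a b c) ?x ?y 1"
  have "line_Q b = tmonom (1 / ?v * (- (b ^ 3) * ?v)) (1, 0, 0) + tmonom (1 / ?v * ?v) (0, 1, 0)
      + tmonom (1 / ?v * 0) (0, 0, 1)"
    using smooth_Q by (simp add: tX_def tY_def tmonom_mult tmonom_uminus)
  moreover have "teval (line_Q b) 0 1 0 \<noteq> 0" by simp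
  then have "line_Q b \<noteq> 0" by (metis teval_0)
  ultimately show ?thesis
    unfolding is_tangent_line_def using smooth_Q
    by (intro conjI exI[of _ ?x] exI[of _ ?y] exI[of _ 1] exI[of _ "1 / ?v"])
       (simp_all only: gradient_Q teval_points, simp_all)
qed

lemma contact_P: "has_intersection_multiplicity C (line_P a) P 3"
proof -
  have "has_intersection_multiplicity C (line_P a) P (Suc 2)"
  proof (rule has_intersection_multiplicity_line)
    show "linear_frame (param_P a) (line_P a) tZ" by (rule linear_frame_P)
    show "primeideal P tring" by (rule plane_pointsD(1)[OF points_plane(3)])
    show "C = line_P a * cofactor_P a b c + tZ * param_P a ^ Suc 2" by (simp add: quartic_P)
    show "is_form 1 tZ" by simp
    show "line_P a dvd A" if "line_P a dvd param_P a * A" for A by (rule line_P_cancel[OF that])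
  qed simp_all
  then show ?thesis by simp
qed

lemma contact_Q: "has_intersection_multiplicity C (line_Q b) Q 3"
proof -
  have "has_intersection_multiplicity C (line_Q b) Q (Suc 2)"
  proof (rule has_intersection_multiplicity_line)
    show "linear_frame (param_Q a b) (line_Q b) tZ" by (rule linear_frame_Q)
    show "primeideal Q tring" by (rule plane_pointsD(1)[OF points_plane(4)])
    show "C = line_Q b * cofactor_Q a b c + tX * param_Q a b ^ Suc 2" by (simp add: quartic_Q)
    show "is_form 1 tX" by simp
    show "line_Q b dvd A" if "line_Q b dvd param_Q a b * A" for A by (rule line_Q_cancel[OF b that])
    show "line_Q b \<in> Q" by (rule Q_on_line)
    show "tX \<notin> Q" using a b by simp
  qed simp_all
  then show ?thesis by simp
qed

lemma smooth_points:
  "smooth_with C infty tX" "smooth_with C origin tX"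
  "smooth_with C P (param_P a)" "smooth_with C Q (param_Q a b)"
proof -
  have X3: "is_form 3 (1 * tX ^ 3)" by (rule is_form_mult'[OF is_form_1 is_form_power]) simp_all
  have P2: "is_form 3 (tZ * param_P a ^ 2)"
    by (rule is_form_mult'[OF is_form_coordinates(3) is_form_power[OF is_form_lines(3)]]) simp
  have Q2: "is_form 3 (tX * param_Q a b ^ 2)"
    by (rule is_form_mult'[OF is_form_coordinates(1) is_form_power[OF is_form_lines(4)]]) simp
  show "smooth_with C infty tX"
  proof (rule smooth_withI[OF _ linear_frame_coordinates(1) points_plane(1) _ _ _ is_form_cofactor(1) X3])
    show "C = tZ * cofactor_Z a b c + 1 * tX ^ Suc 3" by (simp add: quartic_Z eval_nat_numeral)
  qed (simp_all add: teval_cofactors)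
  show "smooth_with C origin tX"
  proof (rule smooth_withI[OF _ linear_frame_coordinates(2) points_plane(2) _ _ _ is_form_cofactor(2) X3])
    show "C = tY * cofactor_Y a b c + 1 * tX ^ Suc 3" by (simp add: quartic_Y eval_nat_numeral)
  qed (use a b in \<open>simp_all add: teval_cofactors\<close>)
  show "smooth_with C P (param_P a)"
  proof (rule smooth_withI[OF _ linear_frame_P points_plane(3) _ _ _ is_form_cofactor(3) P2])
    show "C = line_P a * cofactor_P a b c + tZ * param_P a ^ Suc 2" by (simp add: quartic_P)
  qed (use smooth_P in simp_all)
  show "smooth_with C Q (param_Q a b)"
  proof (rule smooth_withI[OF _ linear_frame_Q points_plane(4) _ Q_on_line _ is_form_cofactor(4) Q2])
    show "C = line_Q b * cofactor_Q a b c + tX * param_Q a b ^ Suc 2" by (simp add: quartic_Q)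
  qed (use smooth_Q in simp_all)
qed

definition param :: "tpoly set \<Rightarrow> tpoly" where
  "param p = (if p = P then param_P a else if p = Q then param_Q a b else tX)"

lemma param_simps [simp]: "param infty = tX" "param origin = tX" "param P = param_P a" "param Q = param_Q a b"
  by (simp_all add: param_def)

text \<open>All zeros of the four linear forms lie among the four special points, so their divisors are
determined by the behaviour at these points. The point \<open>r\<close> of the curve, where \<open>L\<close> does not vanish,
shows that \<open>L\<close> is not a multiple of \<open>C\<close>.\<close>
lemma form_divisor_line:
  assumes L: "is_form 1 L"
    and closed: "\<And>p. p \<in> closed_points C \<Longrightarrow> L \<in> p \<Longrightarrow> p \<in> {infty, origin, P, Q}"
    and order: "\<And>p. p \<in> {infty, origin, P, Q} \<Longrightarrow> E p = 0 \<and> L \<notin> p \<or> local_order C p (param p) 1 L (E p)"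
    and support: "\<And>p. p \<notin> {infty, origin, P, Q} \<Longrightarrow> E p = 0"
    and r: "r \<in> {infty, origin, P, Q}" "L \<notin> r"
  shows "form_divisor C param 1 L E"
  unfolding form_divisor_def
proof (intro conjI ballI)
  show "\<not> C dvd L"
  proof
    assume "C dvd L"
    moreover have "C \<in> r" "primeideal r tring" using r plane_pointsD(1) by auto
    ultimately have "L \<in> r" using ideal_of_typeD(4)[OF primeideal_of_typeD(1)] by (auto elim!: dvdE)
    then show False using r by simp
  qed
  fix p assume p: "p \<in> closed_points C"
  show "E p = 0 \<and> L \<notin> p \<or> smooth_with C p (param p) \<and> local_order C p (param p) 1 L (E p)"
  proof (cases "p \<in> {infty, origin, P, Q}")
    case True
    then have "smooth_with C p (param p)" using smooth_points by auto
    then show ?thesis using order[OF True] by blast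
  next
    case False
    then show ?thesis using closed[OF p] support[OF False] by blast
  qed
qed (rule L)

lemma notin_cofactors:
  "cofactor_Z a b c \<notin> infty" "cofactor_Y a b c \<notin> origin" "cofactor_P a b c \<notin> P" "cofactor_Q a b c \<notin> Q"
  using a b smooth_P smooth_Q by (simp_all add: teval_cofactors)

lemma form_divisor_Z: "form_divisor C param 1 tZ (\<lambda>p. if p = infty then 4 else 0)"
proof (rule form_divisor_line[where r = origin])
  fix p assume "p \<in> closed_points C" "tZ \<in> p"
  then show "p \<in> {infty, origin, P, Q}" using meets_Z closed_pointsD by blast
next
  have "local_order C infty tX 1 tZ 4"
  proof (rule local_orderI[where eu = 0 and ev = 3 and U = "- 1" and V = "cofactor_Z a b c"])
    show "C dvd cofactor_Z a b c * tZ - - 1 * tX ^ 4" by (simp add: quartic_Z mult.commute)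
    show "- 1 \<notin> infty" using mem_proj_point_iff[OF is_form_uminus[OF is_form_1]] by simp
  qed (use notin_cofactors is_form_cofactor is_form_uminus[OF is_form_1] in auto)
  then show "(if p = infty then 4 else 0) = 0 \<and> tZ \<notin> p \<or> local_order C p (param p) 1 tZ (if p = infty then 4 else 0)"
    if "p \<in> {infty, origin, P, Q}" for p using that by auto
qed auto

lemma form_divisor_Y: "form_divisor C param 1 tY (\<lambda>p. if p = origin then 4 else 0)"
proof (rule form_divisor_line[where r = infty])
  fix p assume "p \<in> closed_points C" "tY \<in> p"
  then show "p \<in> {infty, origin, P, Q}" using meets_Y closed_pointsD by blast
next
  have "local_order C origin tX 1 tY 4"
  proof (rule local_orderI[where eu = 0 and ev = 3 and U = "- 1" and V = "cofactor_Y a b c"])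
    show "C dvd cofactor_Y a b c * tY - - 1 * tX ^ 4" by (simp add: quartic_Y mult.commute)
    show "- 1 \<notin> origin" using mem_proj_point_iff[OF is_form_uminus[OF is_form_1]] by simp
  qed (use notin_cofactors is_form_cofactor is_form_uminus[OF is_form_1] in auto)
  then show "(if p = origin then 4 else 0) = 0 \<and> tY \<notin> p \<or> local_order C p (param p) 1 tY (if p = origin then 4 else 0)"
    if "p \<in> {infty, origin, P, Q}" for p using that a b by auto
qed auto

lemma form_divisor_line_P:
  "form_divisor C param 1 (line_P a) (\<lambda>p. if p = P then 3 else if p = infty then 1 else 0)"
proof (rule form_divisor_line[where r = origin])
  fix p assume "p \<in> closed_points C" "line_P a \<in> p"
  then show "p \<in> {infty, origin, P, Q}" using meets_line_P closed_pointsD by blast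
next
  have Q: "line_P a \<notin> Q" using x_coordinates_differ by simp
  have P: "local_order C P (param_P a) 1 (line_P a) 3"
  proof (rule local_orderI[where eu = 1 and ev = 3 and U = "- tZ" and V = "cofactor_P a b c"])
    show "C dvd cofactor_P a b c * line_P a - - tZ * param_P a ^ 3" by (simp add: quartic_P mult.commute)
    show "- tZ \<notin> P" using mem_proj_point_iff[OF is_form_uminus[OF is_form_coordinates(3)]] by simp
  qed (use notin_cofactors is_form_cofactor is_form_uminus[OF is_form_coordinates(3)] in auto)
  (* modulo C one has V_Z N = V_Z X - a^3 (V_Z Z), and V_Z Z is -X^4 *)
  let ?U = "cofactor_Z a b c + tconst (a ^ 3) * tX ^ 3"
  have U: "is_form 3 ?U"
    by (intro is_form_add is_form_cofactor is_form_cmult is_form_power'[OF is_form_coordinates(1)]) simp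
  have infty: "local_order C infty tX 1 (line_P a) 1"
  proof (rule local_orderI[where eu = 3 and ev = 3 and U = ?U and V = "cofactor_Z a b c"])
    have "cofactor_Z a b c * line_P a - ?U * tX ^ 1 = - tconst (a ^ 3) * C"
      unfolding quartic_Z by (simp add: algebra_simps eval_nat_numeral)
    then show "C dvd cofactor_Z a b c * line_P a - ?U * tX ^ 1" by simp
    show "?U \<notin> infty" using mem_proj_point_iff[OF U] by (simp add: teval_cofactors)
  qed (use notin_cofactors is_form_cofactor U in auto)
  show "(if p = P then 3 else if p = infty then 1 else 0) = 0 \<and> line_P a \<notin> p \<or>
      local_order C p (param p) 1 (line_P a) (if p = P then 3 else if p = infty then 1 else 0)"
    if "p \<in> {infty, origin, P, Q}" for p using that Q P infty a by auto
qed (use a in auto)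

lemma form_divisor_line_Q:
  "form_divisor C param 1 (line_Q b) (\<lambda>p. if p = Q then 3 else if p = origin then 1 else 0)"
proof (rule form_divisor_line[where r = infty])
  fix p assume "p \<in> closed_points C" "line_Q b \<in> p"
  then show "p \<in> {infty, origin, P, Q}" using meets_line_Q closed_pointsD by blast
next
  have P: "line_Q b \<notin> P"
  proof
    assume "line_Q b \<in> P"
    then have "- (a ^ 4) = b ^ 3 * a ^ 3" by simp
    moreover have "a ^ 3 * (a + b ^ 3) = a ^ 4 + b ^ 3 * a ^ 3"
      by (simp add: distrib_left power3_eq_cube power4_eq_xxxx mult_ac)
    ultimately have "a ^ 3 * (a + b ^ 3) = 0" by simp
    then show False using a sum_nonzero by simp
  qed
  have Q: "local_order C Q (param_Q a b) 1 (line_Q b) 3"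
  proof (rule local_orderI[where eu = 1 and ev = 3 and U = "- tX" and V = "cofactor_Q a b c"])
    show "C dvd cofactor_Q a b c * line_Q b - - tX * param_Q a b ^ 3" by (simp add: quartic_Q mult.commute)
    show "- tX \<notin> Q" using mem_proj_point_iff[OF is_form_uminus[OF is_form_coordinates(1)]] a b by simp
  qed (use notin_cofactors is_form_cofactor is_form_uminus[OF is_form_coordinates(1)] in auto)
  (* modulo C one has V_Y M = V_Y Y - b^3 V_Y X, and V_Y Y is -X^4 *)
  let ?U = "- (tX ^ 3 + tconst (b ^ 3) * cofactor_Y a b c)"
  have U: "is_form 3 ?U"
    by (intro is_form_uminus is_form_add is_form_cofactor is_form_cmult is_form_power'[OF is_form_coordinates(1)]) simp
  have origin: "local_order C origin tX 1 (line_Q b) 1"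
  proof (rule local_orderI[where eu = 3 and ev = 3 and U = ?U and V = "cofactor_Y a b c"])
    have "cofactor_Y a b c * line_Q b - ?U * tX ^ 1 = C"
      unfolding quartic_Y by (simp add: algebra_simps eval_nat_numeral)
    then show "C dvd cofactor_Y a b c * line_Q b - ?U * tX ^ 1" by simp
    show "?U \<notin> origin" using mem_proj_point_iff[OF U] a b by (simp add: teval_cofactors)
  qed (use notin_cofactors is_form_cofactor U in auto)
  show "(if p = Q then 3 else if p = origin then 1 else 0) = 0 \<and> line_Q b \<notin> p \<or>
      local_order C p (param p) 1 (line_Q b) (if p = Q then 3 else if p = origin then 1 else 0)"
    if "p \<in> {infty, origin, P, Q}" for p using that Q P origin by auto
qed auto

end

section \<open>Torsion\<close>

context smooth_quartic
begin

text \<open>The forms are \<open>Z^4 Y\<close>, \<open>Y^4 Z\<close>, \<open>N^4 Y\<close> and \<open>M^4 Z\<close>; the common part \<open>4\<infinity> + 4O\<close> of their divisors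
cancels in quotients.\<close>
lemma form_with_divisor_12:
  assumes "R \<in> {infty, origin, P, Q}"
  shows "\<exists>H. form_divisor C param 5 H
           (\<lambda>p. (if p \<in> {infty, origin} then 4 else 0) + (if p = R then 12 else 0))"
proof -
  note prime = prime_elem_quartic[of a b c]
  note pow4 = form_divisor_power[OF prime, where n = 4]
  note mult = form_divisor_mult[OF prime]
  from assms consider "R = infty" | "R = origin" | "R = P" | "R = Q" by blast
  then show ?thesis
  proof cases
    case 1
    show ?thesis
      by (rule exI, rule form_divisor_cong[OF mult[OF pow4[OF form_divisor_Z] form_divisor_Y]]) (auto simp: 1)
  next
    case 2
    show ?thesis
      by (rule exI, rule form_divisor_cong[OF mult[OF pow4[OF form_divisor_Y] form_divisor_Z]]) (auto simp: 2)
  next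
    case 3
    show ?thesis
      by (rule exI, rule form_divisor_cong[OF mult[OF pow4[OF form_divisor_line_P] form_divisor_Y]]) (auto simp: 3)
  next
    case 4
    show ?thesis
      by (rule exI, rule form_divisor_cong[OF mult[OF pow4[OF form_divisor_line_Q] form_divisor_Z]]) (auto simp: 4)
  qed
qed

lemma C_mem_points: "R \<in> {infty, origin, P, Q} \<Longrightarrow> R \<in> closed_points C"
  using infty_closed[of C] origin_closed[of C] P_closed[of C] Q_closed[of C] by auto

lemma torsion_differences:
  assumes R: "R \<in> {infty, origin, P, Q}" and R': "R' \<in> {infty, origin, P, Q}"
  shows "torsion_class C (frag_of R - frag_of R')"
proof -
  obtain H where H: "form_divisor C param 5 H
      (\<lambda>p. (if p \<in> {infty, origin} then 4 else 0) + (if p = R then 12 else 0))"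
    using form_with_divisor_12[OF R] by blast
  obtain H' where H': "form_divisor C param 5 H'
      (\<lambda>p. (if p \<in> {infty, origin} then 4 else 0) + (if p = R' then 12 else 0))"
    using form_with_divisor_12[OF R'] by blast
  show ?thesis
    by (rule torsion_classI[OF prime_elem_quartic H H' C_mem_points[OF R] C_mem_points[OF R'], where n = 12]) auto
qed

lemma points_rational: "{infty, origin, P, Q} \<subseteq> rational_points C"
proof -
  have "proj_point x y z \<in> rational_points C" if "(x, y, z) \<noteq> (0, 0, 0)" "teval C x y z = 0" for x y z
    unfolding rational_points_def using that by blast
  then show ?thesis by simp
qed

lemma defines_elements:
  "defines_K2T_element C infty origin P" "defines_K2T_element C infty origin Q" "defines_K2T_element C infty P Q"
proof -
  have *: "defines_K2T_element C R1 R2 R3"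
    if R: "{R1, R2, R3} \<subseteq> {infty, origin, P, Q}" and "distinct [R1, R2, R3]" for R1 R2 R3
    unfolding defines_K2T_element_def
  proof (intro conjI ballI)
    show "{R1, R2, R3} \<subseteq> rational_points C" using R points_rational by (rule subset_trans)
    show "torsion_class C (frag_of R - frag_of R')" if "R \<in> {R1, R2, R3}" "R' \<in> {R1, R2, R3}" for R R'
      by (rule torsion_differences) (use R that in blast)+
  qed fact
  show "defines_K2T_element C infty origin P" "defines_K2T_element C infty origin Q" "defines_K2T_element C infty P Q"
    by (rule *; simp)+
qed

end

lemma disc_quartic_singular:
  assumes "is_form 3 (dX F)" "is_form 3 (dY F)" "is_form 3 (dZ F)" and "(x, y, z) \<noteq> (0, 0, 0)"
    and "teval (dX F) x y z = 0" "teval (dY F) x y z = 0" "teval (dZ F) x y z = 0"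
  shows "disc_quartic F = 0"
  unfolding disc_quartic_def using resultant_cubics_eq_0[OF assms(1-3) assms(5-7) assms(4)] by simp

lemma smooth_quarticI:
  assumes "a \<noteq> 0" "b \<noteq> 0" and disc: "disc_quartic (quartic a b c) \<noteq> 0"
  shows "smooth_quartic a b c"
proof
  show "teval (cofactor_P a b c) (a ^ 3) (- (a ^ 4)) 1 \<noteq> 0"
  proof
    assume "teval (cofactor_P a b c) (a ^ 3) (- (a ^ 4)) 1 = 0"
    then have "disc_quartic (quartic a b c) = 0"
      by (intro disc_quartic_singular[OF is_form_gradient, of "a ^ 3" "- (a ^ 4)" 1]) (simp_all add: gradient_P)
    then show False using disc by simp
  qed
  show "teval (cofactor_Q a b c) (- (a ^ 2 * b ^ 3)) (- (a ^ 2 * b ^ 6)) 1 \<noteq> 0"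
  proof
    assume "teval (cofactor_Q a b c) (- (a ^ 2 * b ^ 3)) (- (a ^ 2 * b ^ 6)) 1 = 0"
    then have "disc_quartic (quartic a b c) = 0"
      by (intro disc_quartic_singular[OF is_form_gradient, of "- (a ^ 2 * b ^ 3)" "- (a ^ 2 * b ^ 6)" 1])
         (simp_all add: gradient_Q)
    then show False using disc by simp
  qed
qed fact+

theorem theorem5p3:
  fixes a b c :: rat
    and f1 f2 :: "rat poly" and F :: "rat poly poly" and C LP LQ :: tpoly
    and infty origin P Q :: "tpoly set"
  defines "f1 \<equiv> [:a^6 * b^6, a^3 * b^3 * c, 3 * a^2 - b^6 - b^3 * c:]"
    and "f2 \<equiv> [:3 * a^4 - a^3 * c, c:]"
    and "F \<equiv> [:Polynomial.monom 1 4, f1, f2, 1:]"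
    and "C \<equiv> homogenize 4 F"
    and "infty \<equiv> proj_point 0 1 0"
    and "origin \<equiv> proj_point 0 0 1"
    and "P \<equiv> proj_point (a^3) (- (a^4)) 1"
    and "Q \<equiv> proj_point (- (a^2 * b^3)) (- (a^2 * b^6)) 1"
    and "LP \<equiv> homogenize 1 [:[:- (a^3), 1:]:]"
    and "LQ \<equiv> homogenize 1 [:[:0, - (b^3):], 1:]"
  assumes "a \<noteq> 0" and "b \<noteq> 0" and "a \<noteq> b"
    and "disc_quartic C \<noteq> 0"
  shows "(P \<in> rational_points C \<and> is_tangent_line C P LP \<and>
          has_intersection_multiplicity C LP P 3 \<and>
          closed_points C \<inter> closed_points LP = {P, infty} \<and> infty \<noteq> P)
       \<and> (Q \<in> rational_points C \<and> is_tangent_line C Q LQ \<and>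
          has_intersection_multiplicity C LQ Q 3 \<and>
          closed_points C \<inter> closed_points LQ = {Q, origin} \<and> origin \<noteq> Q)
       \<and> (defines_K2T_element C infty origin P \<and>
          defines_K2T_element C infty origin Q \<and>
          defines_K2T_element C infty P Q)"
proof -
  have C: "C = quartic a b c"
    unfolding C_def F_def f1_def f2_def by (rule homogenize_quartic)
  have LP: "LP = tX - tconst (a ^ 3) * tZ"
    unfolding LP_def using homogenize_line[of "- (a ^ 3)" 1 0] by (simp add: tmonom_uminus)
  have LQ: "LQ = tY - tconst (b ^ 3) * tX"
    unfolding LQ_def one_pCons[where 'a = rat] homogenize_line by (simp add: tmonom_uminus)
  have "smooth_quartic a b c"
    using \<open>a \<noteq> 0\<close> \<open>b \<noteq> 0\<close> \<open>disc_quartic C \<noteq> 0\<close> unfolding C by (rule smooth_quarticI)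
  then interpret smooth_quartic a b c .
  show ?thesis
    unfolding C LP LQ infty_def origin_def P_def Q_def
    by (intro conjI tangent_P tangent_Q contact_P contact_Q closed_points_line_P closed_points_line_Q
        defines_elements points_distinct subsetD[OF points_rational] insertI1 insertI2)
qed

end
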